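(* Let $d\ge2$ be even and $k\ge1$. Let $\delta=\delta_{d,k}\in\bigvee^k(\mathbb C^k)^{\otimes d}$ be Cayley's first hyperdeterminant $$\delta=\frac1{k!}\sum_{\pi_1,\dots,\pi_d\in S_k}\mathrm{sgn}(\pi_1)\cdots\mathrm{sgn}(\pi_d)\,\prod_{i=1}^ke_{\pi_1(i),\dots,\pi_d(i)}.$$ Then for every $n\ge1$, $$\delta^n=\sum_{S\in A^{\mathrm{lex}}((k\times n)^d)}\Delta_S(\mathsf I_n)\,\textstyle\bigvee e_S,$$ where for each $S$ the polynomial $\Delta_S$ is taken in $\bigvee(\mathbb C^n)^{\otimes d}$. In particular, the coefficient of $\delta^{k^{d-1}}$ at the monomial $\bigvee e_{[k]^d}=\prod_{\mathbf i\in[k]^d}e_{\mathbf i}$ equals $\pm\mathrm{AT}_d(k)$.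
   Context: For $N\ge1$, $\bigvee(\mathbb C^N)^{\otimes d}$ is the polynomial ring in commuting variables $e_{\mathbf i}$, $\mathbf i\in[N]^d$. $k\times n$ denotes the partition $(n,n,\dots,n)$ with $k$ parts, and $(k\times n)^d$ the $d$-tuple of copies of it. For a sequence $\alpha$ with sum $m$, $A(\alpha)$ is the set of words of length $m$ in which letter $i$ occurs $\alpha_i$ times; $A(\pmb\alpha)=A(\alpha^{(1)})\times\cdots\times A(\alpha^{(d)})$ is viewed as $d\times m$ tables with columns $S(1),\dots,S(m)$; $A^{\mathrm{lex}}(\pmb\alpha)$ consists of those with lexicographically weakly increasing columns. $\bigvee e_S=e_{S(1)}\cdots e_{S(m)}$. $\|T\|=\prod_{\mathbf c}(\#\{j:T(j)=\mathbf c\})!$. Signs: $(-1)^w=(-1)^{\#\{i<j:w_i>w_j\}}$; $(-1)^T=\prod_i(-1)^{t_i}$ over rows $t_i$. For words $s,x$ of length $m$, $\mathrm{sgn}_s(x)=\prod_c\mathrm{sgn}(x_{b_1},\dots,x_{b_r})$ over letters $c$ of $s$ with positions $b_1<\dots<b_r$, where $\mathrm{sgn}(a_1,\dots,a_r)$ is the permutation sign if $(a_1,\dots,a_r)$ is a permutation of $[r]$ and $0$ otherwise; $\mathrm{sgn}_T(X)=\prod_i\mathrm{sgn}_{t_i}(x_i)$. For a $d\times m$ table $T$ of positive integers, $\Delta_T=\frac{(-1)^T}{\|T\|}\sum_X\mathrm{sgn}_T(X)\bigvee e_X\in\bigvee(\mathbb C^n)^{\otimes d}$, the sum over all $d\times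 m$ tables $X$ with entries in $[n]$. $\Delta_S(\mathsf I_n)$ denotes the value of the polynomial $\Delta_S$ at the unit tensor $\mathsf I_n=\sum_{i=1}^ne_i\otimes\cdots\otimes e_i$, i.e. after substituting $e_{\mathbf i}\mapsto1$ if $i_1=\dots=i_d$ and $e_{\mathbf i}\mapsto0$ otherwise. Latin hypercubes: a $d$-dimensional Latin hypercube of order $k$ is a map $L:[k]^d\to[k^{d-1}]$ such that for every direction $\ell\in[d]$ and $j\in[k]$, the restriction of $L$ to the slice $\{\mathbf i:i_\ell=j\}$ (which has $k^{d-1}$ cells) is a bijection onto $[k^{d-1}]$. Its sign $\mathrm{sgn}(L)$ is the product over all $dk$ slices of the signs of the permutations obtained by reading $L$ on the slice in lexicographic order of cells. $\mathrm{AT}_d(k)=\sum_L\mathrm{sgn}(L)$ over all such $L$. *)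

theory Defs
  imports
    Complex_Main
    "HOL-Library.Poly_Mapping"
    "HOL-Library.List_Lexorder"
    "HOL-Library.FuncSet"
    "HOL-Combinatorics.Permutations"
begin

subsection \<open>Polynomials in the variables \<open>e\<^sub>i\<close>\<close>

text \<open>
  A multi-index \<open>(i\<^sub>1, \<dots>, i\<^sub>d)\<close> is a list of length \<open>d\<close> with entries in \<open>{1..N}\<close>.
  All the rings \<open>\<Or>(\<complex>\<^sup>N)\<^sup>\<otimes>\<^sup>d\<close> are subrings (\<open>tensor_ring N d\<close>) of one
  polynomial ring whose variables are indexed by arbitrary lists.
\<close>

type_synonym tensor_poly = "(nat list \<Rightarrow>\<^sub>0 nat) \<Rightarrow>\<^sub>0 complex"

definition cells :: "nat \<Rightarrow> nat \<Rightarrow> nat list set" where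
  "cells d N = {c. length c = d \<and> set c \<subseteq> {1..N}}"

definition tensor_ring :: "nat \<Rightarrow> nat \<Rightarrow> tensor_poly set" where
  "tensor_ring N d = {p. \<forall>\<mu>\<in>Poly_Mapping.keys p. Poly_Mapping.keys \<mu> \<subseteq> cells d N}"

definition evar :: "nat list \<Rightarrow> tensor_poly" where
  "evar c = Poly_Mapping.single (Poly_Mapping.single c 1) 1"

definition Const :: "complex \<Rightarrow> tensor_poly" where
  "Const a = Poly_Mapping.single 0 a"

definition eval_poly :: "(nat list \<Rightarrow> complex) \<Rightarrow> tensor_poly \<Rightarrow> complex" where
  "eval_poly f p = (\<Sum>\<mu>\<in>Poly_Mapping.keys p. Poly_Mapping.lookup p \<mu> *
     (\<Prod>c\<in>Poly_Mapping.keys \<mu>. f c ^ Poly_Mapping.lookup \<mu> c))"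

text \<open>The coordinates of the unit tensor \<open>\<Sum>a=1..n. e\<^sub>a \<otimes> \<dots> \<otimes> e\<^sub>a\<close>.\<close>

definition unit_tensor :: "nat \<Rightarrow> nat \<Rightarrow> nat list \<Rightarrow> complex" where
  "unit_tensor d n c = (if \<exists>a\<in>{1..n}. c = replicate d a then 1 else 0)"


subsection \<open>Words and tables\<close>

text \<open>
  A table is the list of its rows. Positions in words and tables are 0-based, whereas
  letters are positive.
\<close>

definition words :: "nat list \<Rightarrow> nat list set" where
  "words \<alpha> = {w. length w = sum_list \<alpha> \<and> set w \<subseteq> {1..length \<alpha>} \<and>
     (\<forall>i<length \<alpha>. count_list w (Suc i) = \<alpha> ! i)}"

definition tables :: "nat list list \<Rightarrow> nat list list set" where
  "tables \<alpha>s = {T. list_all2 (\<lambda>t \<alpha>. t \<in> words \<alpha>) T \<alpha>s}"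

definition columns :: "nat list list \<Rightarrow> nat list list" where
  "columns T = map (\<lambda>j. map (\<lambda>t. t ! j) T) [0..<length (hd T)]"

definition lex_tables :: "nat list list \<Rightarrow> nat list list set" where
  "lex_tables \<alpha>s = {T \<in> tables \<alpha>s. sorted (columns T)}"

definition all_tables :: "nat \<Rightarrow> nat \<Rightarrow> nat \<Rightarrow> nat list list set" where
  "all_tables d m n = {X. length X = d \<and> (\<forall>x\<in>set X. length x = m \<and> set x \<subseteq> {1..n})}"

definition vee :: "nat list list \<Rightarrow> tensor_poly" where
  "vee T = prod_list (map evar (columns T))"

definition table_norm :: "nat list list \<Rightarrow> nat" where
  "table_norm T = (\<Prod>c\<in>set (columns T). fact (count_list (columns T) c))"

definition word_sign :: "nat list \<Rightarrow> int" where
  "word_sign w = (- 1) ^ card {(i, j). i < j \<and> j < length w \<and> w ! i > w ! j}"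

definition table_sign :: "nat list list \<Rightarrow> int" where
  "table_sign T = prod_list (map word_sign T)"

text \<open>The sign of a sequence that lists the values of a permutation of \<open>{1..r}\<close>, and 0 for others.\<close>

definition seq_sgn :: "nat list \<Rightarrow> int" where
  "seq_sgn a = (if distinct a \<and> set a = {1..length a}
     then sign (\<lambda>i. if i \<in> {1..length a} then a ! (i - 1) else i) else 0)"

definition sgn_word :: "nat list \<Rightarrow> nat list \<Rightarrow> int" where
  "sgn_word s x = (\<Prod>c\<in>set s. seq_sgn (map (\<lambda>b. x ! b) (filter (\<lambda>b. s ! b = c) [0..<length s])))"

definition sgn_table :: "nat list list \<Rightarrow> nat list list \<Rightarrow> int" where
  "sgn_table T X = (\<Prod>i<length T. sgn_word (T ! i) (X ! i))"

definition Delta :: "nat \<Rightarrow> nat list list \<Rightarrow> tensor_poly" where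
  "Delta n T = Const (of_int (table_sign T) / of_nat (table_norm T)) *
     (\<Sum>X\<in>all_tables (length T) (length (hd T)) n. of_int (sgn_table T X) * vee X)"


subsection \<open>Cayley's first hyperdeterminant\<close>

definition hyperdet :: "nat \<Rightarrow> nat \<Rightarrow> tensor_poly" where
  "hyperdet d k = Const (1 / fact k) *
     (\<Sum>\<pi>s\<in>{\<pi>s. length \<pi>s = d \<and> (\<forall>\<pi>\<in>set \<pi>s. \<pi> permutes {1..k})}.
        of_int (prod_list (map sign \<pi>s)) * (\<Prod>i\<in>{1..k}. evar (map (\<lambda>\<pi>. \<pi> i) \<pi>s)))"


subsection \<open>Latin hypercubes\<close>

definition slice :: "nat \<Rightarrow> nat \<Rightarrow> nat \<Rightarrow> nat \<Rightarrow> nat list set" where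
  "slice d k l j = {c \<in> cells d k. c ! l = j}"

definition latin_hypercubes :: "nat \<Rightarrow> nat \<Rightarrow> (nat list \<Rightarrow> nat) set" where
  "latin_hypercubes d k = {L \<in> cells d k \<rightarrow>\<^sub>E {1..k ^ (d - 1)}.
     \<forall>l<d. \<forall>j\<in>{1..k}. bij_betw L (slice d k l j) {1..k ^ (d - 1)}}"

text \<open>Lists are ordered lexicographically here, hence so are the cells of a slice.\<close>

definition latin_sign :: "nat \<Rightarrow> nat \<Rightarrow> (nat list \<Rightarrow> nat) \<Rightarrow> int" where
  "latin_sign d k L = (\<Prod>l<d. \<Prod>j\<in>{1..k}. seq_sgn (map L (sorted_list_of_set (slice d k l j))))"

definition AT :: "nat \<Rightarrow> nat \<Rightarrow> int" where
  "AT d k = (\<Sum>L\<in>latin_hypercubes d k. latin_sign d k L)"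

text \<open>The exponent vector of the product of all variables \<open>e\<^sub>i\<close> with \<open>i\<close> in \<open>{1..k}\<^sup>d\<close>.\<close>

definition full_monomial :: "nat \<Rightarrow> nat \<Rightarrow> nat list \<Rightarrow>\<^sub>0 nat" where
  "full_monomial d k = (\<Sum>c\<in>cells d k. Poly_Mapping.single c 1)"

lemma prod_evar:
  "(\<Prod>c\<in>A. evar c) = Poly_Mapping.single (\<Sum>c\<in>A. Poly_Mapping.single c 1) 1"
  by (induction A rule: infinite_finite_induct) (auto simp: evar_def mult_single)

lemma prod_cells_eq_full_monomial:
  "(\<Prod>c\<in>cells d k. evar c) = Poly_Mapping.single (full_monomial d k) 1"
  by (simp add: prod_evar full_monomial_def)


subsection \<open>Membership in the polynomial rings\<close>

lemma tensor_ring_Const: "Const a \<in> tensor_ring N d"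
  by (simp add: tensor_ring_def Const_def)

lemma tensor_ring_0: "0 \<in> tensor_ring N d"
  by (simp add: tensor_ring_def)

lemma tensor_ring_1: "1 \<in> tensor_ring N d"
  by (simp add: tensor_ring_def)

lemma tensor_ring_of_int: "of_int z \<in> tensor_ring N d"
  using tensor_ring_Const[of "of_int z"] by (simp add: Const_def)

lemma tensor_ring_evar: "c \<in> cells d N \<Longrightarrow> evar c \<in> tensor_ring N d"
  by (simp add: tensor_ring_def evar_def)

lemma tensor_ring_add:
  "p \<in> tensor_ring N d \<Longrightarrow> q \<in> tensor_ring N d \<Longrightarrow> p + q \<in> tensor_ring N d"
  unfolding tensor_ring_def using Poly_Mapping.keys_add[of p q] by blast

lemma tensor_ring_mult:
  assumes "p \<in> tensor_ring N d" "q \<in> tensor_ring N d"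
  shows "p * q \<in> tensor_ring N d"
proof -
  have "Poly_Mapping.keys \<mu> \<subseteq> cells d N" if mu: "\<mu> \<in> Poly_Mapping.keys (p * q)" for \<mu>
  proof -
    obtain a b where "\<mu> = a + b" "a \<in> Poly_Mapping.keys p" "b \<in> Poly_Mapping.keys q"
      using mu keys_mult[of p q] by blast
    then show ?thesis
      using assms Poly_Mapping.keys_add[of a b] unfolding tensor_ring_def by blast
  qed
  then show ?thesis by (simp add: tensor_ring_def)
qed

lemma tensor_ring_sum:
  "(\<And>x. x \<in> A \<Longrightarrow> f x \<in> tensor_ring N d) \<Longrightarrow> sum f A \<in> tensor_ring N d"
  by (induction A rule: infinite_finite_induct) (auto intro: tensor_ring_0 tensor_ring_add)

lemma tensor_ring_prod:
  "(\<And>x. x \<in> A \<Longrightarrow> f x \<in> tensor_ring N d) \<Longrightarrow> prod f A \<in> tensor_ring N d"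
  by (induction A rule: infinite_finite_induct) (auto intro: tensor_ring_1 tensor_ring_mult)

lemma tensor_ring_prod_list:
  "(\<And>x. x \<in> set xs \<Longrightarrow> x \<in> tensor_ring N d) \<Longrightarrow> prod_list xs \<in> tensor_ring N d"
  by (induction xs) (auto intro: tensor_ring_1 tensor_ring_mult)

lemma hyperdet_in_tensor_ring: "hyperdet d k \<in> tensor_ring k d"
  unfolding hyperdet_def
proof (intro tensor_ring_mult tensor_ring_Const tensor_ring_sum tensor_ring_of_int
    tensor_ring_prod tensor_ring_evar)
  fix \<pi>s :: "(nat \<Rightarrow> nat) list" and i
  assume "\<pi>s \<in> {\<pi>s. length \<pi>s = d \<and> (\<forall>\<pi>\<in>set \<pi>s. \<pi> permutes {1..k})}" "i \<in> {1..k}"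
  then show "map (\<lambda>\<pi>. \<pi> i) \<pi>s \<in> cells d k"
    by (auto simp: cells_def permutes_in_image simp del: atLeastAtMost_iff)
qed

lemma vee_in_tensor_ring:
  assumes X: "X \<in> all_tables d m n"
  shows "vee X \<in> tensor_ring n d"
  unfolding vee_def
proof (intro tensor_ring_prod_list)
  fix p assume "p \<in> set (map evar (columns X))"
  then obtain j where j: "j < length (hd X)" and p: "p = evar (map (\<lambda>t. t ! j) X)"
    by (auto simp: columns_def)
  have "t ! j \<in> {1..n}" if "t \<in> set X" for t
  proof -
    have "hd X \<in> set X" using that by (intro hd_in_set) auto
    then have "j < length t" using j X that by (auto simp: all_tables_def)
    then have "t ! j \<in> set t" by simp
    then show ?thesis using X that unfolding all_tables_def by blast
  qed
  moreover have "length X = d" using X by (simp add: all_tables_def)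
  ultimately show "p \<in> tensor_ring n d"
    unfolding p by (intro tensor_ring_evar) (auto simp: cells_def)
qed

lemma Delta_in_tensor_ring: "Delta n T \<in> tensor_ring n (length T)"
  unfolding Delta_def
  by (intro tensor_ring_mult tensor_ring_Const tensor_ring_sum tensor_ring_of_int)
    (rule vee_in_tensor_ring)

end

theory Submission
  imports Defs "HOL-Library.Product_Lexorder" "HOL-Combinatorics.Multiset_Permutations"
begin

text \<open>
  Write \<open>m = n k\<close>. For a word \<open>w\<close> in which each of the letters \<open>1, \<dots>, n\<close> occurs \<open>k\<close> times, put
  \<open>Z(w) = \<Sum>T. sgn\<^sub>w(t\<^sub>1) \<cdots> sgn\<^sub>w(t\<^sub>d) \<Or>e\<^sub>T\<close>, the sum over all tables \<open>T\<close> with entries in \<open>{1..k}\<close>.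
  For \<open>w = 1\<dots>12\<dots>2\<dots>n\<dots>n\<close> this factors into \<open>n\<close> blocks, so \<open>Z(w) = k!\<^sup>n \<delta>\<^sup>n\<close>. As \<open>d\<close> is even, the
  product of signs does not change when the columns of \<open>w\<close> and \<open>T\<close> are permuted simultaneously;
  hence \<open>Z(w)\<close> is the same for all \<open>w\<close>, and averaging over \<open>w\<close> gives \<open>m! \<delta>\<^sup>n = \<Sum>w. Z(w)\<close>.
  Collecting the tables \<open>T\<close> with the same multiset of columns turns this into a sum over tables
  \<open>S\<close> with sorted columns, each counted \<open>m!/\<parallel>S\<parallel>\<close> times. Finally, for even \<open>d\<close>,
  \<open>(-1)\<^sup>S \<Prod>i. sgn\<^bsub>s\<^sub>i\<^esub>(w) = \<Prod>i. sgn\<^sub>w(s\<^sub>i)\<close>, and only tables with constant columns contribute to the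
  value of \<open>\<Delta>\<^sub>S\<close> at the unit tensor.

  The coefficient in question belongs to the table whose columns are all the cells; a word of
  length \<open>k\<^sup>d\<close> is then a labelling of the cells, and the nonzero terms are the Latin hypercubes.
\<close>

subsection \<open>Signs as products over pairs of positions\<close>

definition pairs :: "'a::linorder set \<Rightarrow> ('a \<times> 'a) set" where
  "pairs A = {(i, j). i \<in> A \<and> j \<in> A \<and> i < j}"

text \<open>The contribution of one pair to the inversion formula for the sign of a permutation.
  Equal entries do not count as an inversion.\<close>

definition order_sign :: "'a::linorder \<Rightarrow> 'a \<Rightarrow> int" where
  "order_sign a b = (if b < a then - 1 else 1)"

lemma order_sign_swap: "a \<noteq> b \<Longrightarrow> order_sign b a = - order_sign a b"
  by (auto simp: order_sign_def)

lemma order_sign_square [simp]: "order_sign a b * order_sign a b = 1"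
  by (auto simp: order_sign_def)

lemma finite_pairs [simp]: "finite A \<Longrightarrow> finite (pairs A)"
  by (rule finite_subset[of _ "A \<times> A"]) (auto simp: pairs_def)

text \<open>A bijection may reverse the order within a pair, which a symmetric \<open>g\<close> does
  not notice. This allows the positions to be reordered freely.\<close>

lemma prod_pairs_reindex:
  fixes A :: "'a::linorder set" and B :: "'b::linorder set"
  assumes bij: "bij_betw f A B"
    and sym: "\<And>x y. x \<in> B \<Longrightarrow> y \<in> B \<Longrightarrow> x \<noteq> y \<Longrightarrow> g x y = g y x"
  shows "(\<Prod>(i, j)\<in>pairs A. g (f i) (f j)) = (\<Prod>(i, j)\<in>pairs B. g i j)"
proof -
  \<comment> \<open>\<open>h\<close> puts the two images in increasing order, so that they form an
    element of \<open>pairs B\<close>.\<close>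
  define h where "h = (\<lambda>(i, j). if f i < f j then (f i, f j) else (f j, f i))"
  have inj: "inj_on f A" and im: "f ` A = B"
    using bij by (auto simp: bij_betw_def)
  have fB: "f i \<in> B" if "i \<in> A" for i using im that by auto
  have "bij_betw h (pairs A) (pairs B)"
    unfolding bij_betw_def
  proof
    show "inj_on h (pairs A)"
      by (rule inj_onI)
        (auto simp: h_def pairs_def inj_on_eq_iff[OF inj] split: if_splits)
    show "h ` pairs A = pairs B"
    proof (intro equalityI subsetI)
      fix p assume "p \<in> h ` pairs A"
      then obtain i j where ij: "i \<in> A" "j \<in> A" "i < j" "p = h (i, j)"
        by (auto simp: pairs_def)
      then have "f i \<noteq> f j" using inj by (auto dest: inj_onD)
      then show "p \<in> pairs B" using ij fB by (auto simp: h_def pairs_def)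
    next
      fix p assume "p \<in> pairs B"
      then obtain i j where ij: "i \<in> A" "j \<in> A" "f i < f j" "p = (f i, f j)"
        using im by (auto simp: pairs_def)
      then have "i < j \<or> j < i" by (metis less_irrefl linorder_neqE)
      then have "p = h (i, j) \<and> (i, j) \<in> pairs A \<or> p = h (j, i) \<and> (j, i) \<in> pairs A"
        using ij by (auto simp: h_def pairs_def)
      then show "p \<in> h ` pairs A" by blast
    qed
  qed
  from prod.reindex_bij_betw[OF this, of "\<lambda>(i, j). g i j"]
  have "(\<Prod>(i, j)\<in>pairs B. g i j) = (\<Prod>p\<in>pairs A. case h p of (i, j) \<Rightarrow> g i j)" by simp
  also have "\<dots> = (\<Prod>(i, j)\<in>pairs A. g (f i) (f j))"
  proof (intro prod.cong refl, clarify)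
    fix i j assume "(i, j) \<in> pairs A"
    then have "f i \<in> B" "f j \<in> B" "f i \<noteq> f j"
      using fB inj_on_eq_iff[OF inj] by (auto simp: pairs_def)
    then show "(case h (i, j) of (i, j) \<Rightarrow> g i j) = g (f i) (f j)"
      using sym by (auto simp: h_def)
  qed
  finally show ?thesis by simp
qed

text \<open>Splits off the pairs that contain \<open>a\<close>; symmetry of \<open>g\<close> lets
  \<open>a\<close> be written first in all of them.\<close>

lemma prod_pairs_insert:
  fixes A :: "'a::linorder set"
  assumes "finite A" "a \<notin> A" and sym: "\<And>x y. x \<noteq> y \<Longrightarrow> g x y = g y x"
  shows "(\<Prod>(i, j)\<in>pairs (insert a A). g i j) = (\<Prod>c\<in>A. g a c) * (\<Prod>(i, j)\<in>pairs A. g i j)"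
proof -
  define h where "h = (\<lambda>c. if a < c then (a, c) else (c, a))"
  have eq: "pairs (insert a A) = h ` A \<union> pairs A"
    using assms(2) by (auto simp: pairs_def h_def image_iff) (metis neqE)
  have disj: "h ` A \<inter> pairs A = {}"
    using assms(2) by (auto simp: pairs_def h_def split: if_splits)
  have inj: "inj_on h A"
    using assms(2) by (auto simp: inj_on_def h_def split: if_splits)
  have "(\<Prod>(i, j)\<in>h ` A. g i j) = (\<Prod>c\<in>A. g a c)"
    unfolding prod.reindex[OF inj]
  proof (intro prod.cong refl)
    fix c assume "c \<in> A"
    then have "c \<noteq> a" using assms(2) by auto
    then show "((\<lambda>(i, j). g i j) \<circ> h) c = g a c" using sym[of c a] by (auto simp: h_def)
  qed
  then show ?thesis
    unfolding eq using assms(1) disj by (subst prod.union_disjoint) auto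
qed

text \<open>An increasing enumeration keeps the order within every pair, so the reindexing works for
  arbitrary \<open>g\<close>, in contrast to \<open>prod_pairs_reindex\<close>.\<close>

lemma prod_pairs_mono_reindex:
  assumes "sorted xs" "distinct xs"
  shows "(\<Prod>(i, j)\<in>pairs {..<length xs}. g (xs ! i) (xs ! j)) = (\<Prod>(i, j)\<in>pairs (set xs). g i j)"
proof -
  have less: "xs ! i < xs ! j \<longleftrightarrow> i < j" if "i < length xs" "j < length xs" for i j
    using assms that
    by (metis linorder_less_linear not_less_iff_gr_or_eq sorted_wrt_nth_less strict_sorted_iff)
  have "bij_betw (\<lambda>(i, j). (xs ! i, xs ! j)) (pairs {..<length xs}) (pairs (set xs))"
    unfolding bij_betw_def
  proof
    show "inj_on (\<lambda>(i, j). (xs ! i, xs ! j)) (pairs {..<length xs})"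
      using assms(2) by (auto simp: inj_on_def pairs_def nth_eq_iff_index_eq)
    show "(\<lambda>(i, j). (xs ! i, xs ! j)) ` pairs {..<length xs} = pairs (set xs)"
    proof (intro equalityI subsetI)
      fix p assume "p \<in> pairs (set xs)"
      then obtain i j where "i < length xs" "j < length xs" "xs ! i < xs ! j" "p = (xs ! i, xs ! j)"
        by (auto simp: pairs_def in_set_conv_nth)
      then show "p \<in> (\<lambda>(i, j). (xs ! i, xs ! j)) ` pairs {..<length xs}"
        using less by (intro image_eqI[of _ _ "(i, j)"]) (auto simp: pairs_def)
    qed (auto simp: pairs_def less)
  qed
  from prod.reindex_bij_betw[OF this, of "\<lambda>(i, j). g i j"]
  show ?thesis by (simp add: case_prod_unfold)
qed

text \<open>The inversion formula, by induction over transpositions: composing with a transposition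
  multiplies the product by -1.\<close>

lemma sign_eq_prod_pairs:
  fixes A :: "'a::linorder set"
  assumes "finite A" "p permutes A"
  shows "sign p = (\<Prod>(i, j)\<in>pairs A. order_sign (p i) (p j))"
  using assms(2,1)
proof (induction rule: permutes_induct)
  case id
  have "(\<Prod>(i, j)\<in>pairs A. order_sign (id i) (id j)) = 1"
    by (rule prod.neutral) (auto simp: order_sign_def pairs_def)
  then show ?case by simp
next
  case (swap a b p)
  note ne = swap.hyps(3)
  \<comment> \<open>\<open>g x y\<close> is the factor by which the transposition changes the
    contribution of a pair with values \<open>x\<close> and \<open>y\<close>.\<close>
  define g where "g = (\<lambda>x y. order_sign (transpose a b x) (transpose a b y) * order_sign x y)"
  have g_sym: "g x y = g y x" if "x \<noteq> y" for x y
  proof -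
    have "transpose a b x \<noteq> transpose a b y" using that by (metis transpose_involutory)
    then show ?thesis using that by (simp add: g_def order_sign_swap[of x y]
        order_sign_swap[of "transpose a b x" "transpose a b y"])
  qed
  define C where "C = A - {a, b}"
  have C: "A = insert a (insert b C)" "finite C" "a \<notin> insert b C" "b \<notin> C"
    using swap.hyps assms(1) by (auto simp: C_def)
  have "(\<Prod>(i, j)\<in>pairs A. g i j)
      = g a b * ((\<Prod>c\<in>C. g a c) * (\<Prod>c\<in>C. g b c)) * (\<Prod>(i, j)\<in>pairs C. g i j)"
    using C g_sym by (simp add: prod_pairs_insert)
  also have "(\<Prod>(i, j)\<in>pairs C. g i j) = 1"
    by (rule prod.neutral) (auto simp: g_def pairs_def C_def transpose_def)
  \<comment> \<open>For a third element \<open>c\<close>, the transposition exchanges the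
    comparisons of \<open>c\<close> with \<open>a\<close> and with \<open>b\<close>, so the two
    factors cancel. Only the pair of \<open>a\<close> and \<open>b\<close> itself changes
    sign.\<close>
  also have "(\<Prod>c\<in>C. g a c) * (\<Prod>c\<in>C. g b c) = 1"
    unfolding prod.distrib[symmetric]
    by (rule prod.neutral) (auto simp: g_def C_def transpose_def order_sign_def)
  also have "g a b = - 1" using ne by (auto simp: g_def order_sign_def)
  finally have gA: "(\<Prod>(i, j)\<in>pairs A. g i j) = - 1" by simp
  \<comment> \<open>Passes from arguments to values of \<open>p\<close>, which run through the same
    pairs up to order.\<close>
  have "(\<Prod>(i, j)\<in>pairs A. g (p i) (p j)) = (\<Prod>(i, j)\<in>pairs A. g i j)"
    using g_sym permutes_imp_bij[OF swap.hyps(4)] by (intro prod_pairs_reindex)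
  then have "(\<Prod>(i, j)\<in>pairs A. order_sign ((transpose a b \<circ> p) i) ((transpose a b \<circ> p) j))
      * (\<Prod>(i, j)\<in>pairs A. order_sign (p i) (p j)) = - 1"
    using gA by (simp add: g_def prod.distrib case_prod_unfold)
  moreover have "sign p = (\<Prod>(i, j)\<in>pairs A. order_sign (p i) (p j))"
    by (rule swap.IH)
  moreover have "sign (transpose a b \<circ> p) = - sign p"
  proof -
    have "permutation p" using swap.hyps assms(1) permutation_permutes by blast
    then show ?thesis using ne by (simp add: sign_compose permutation_swap_id sign_swap_id)
  qed
  \<comment> \<open>Used with \<open>x\<close> and \<open>y\<close> the products for the composed
    permutation and for \<open>p\<close>, and \<open>s\<close> the sign of \<open>p\<close>: as
    \<open>y\<close> is 1 or -1, \<open>x * y = - 1\<close> determines \<open>x\<close>.\<close>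
  moreover have "z = x" if "x * y = - 1" "s = y" "z = - s" "s = 1 \<or> s = - 1" for x y z s :: int
    using that by auto
  moreover have "sign p = 1 \<or> sign p = - 1" by (cases p rule: sign_cases) auto
  ultimately show ?case by blast
qed

text \<open>Transfers the inversion formula from the arguments \<open>{1..length a}\<close> of the
  permutation to the 0-based positions in the list.\<close>

lemma seq_sgn_eq_prod_pairs:
  "seq_sgn a = (if distinct a \<and> set a = {1..length a}
     then \<Prod>(i, j)\<in>pairs {..<length a}. order_sign (a ! i) (a ! j) else 0)"
proof (cases "distinct a \<and> set a = {1..length a}")
  case True
  define p where "p = (\<lambda>i. if i \<in> {1..length a} then a ! (i - 1) else i)"
  have bij: "bij_betw (\<lambda>i. i - 1) {1..length a} {..<length a}"
    by (rule bij_betw_byWitness[of _ Suc]) auto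
  have "bij_betw ((!) a \<circ> (\<lambda>i. i - 1)) {1..length a} {1..length a}"
    using bij bij_betw_nth[of a "{..<length a}" "{1..length a}"] True
    by (intro bij_betw_trans[OF bij]) auto
  then have "bij_betw p {1..length a} {1..length a}"
    by (rule bij_betw_cong[THEN iffD1, rotated]) (auto simp: p_def)
  then have "p permutes {1..length a}"
    by (rule bij_imp_permutes) (auto simp: p_def)
  then have "sign p = (\<Prod>(i, j)\<in>pairs {1..length a}. order_sign (p i) (p j))"
    by (intro sign_eq_prod_pairs) auto
  also have "\<dots> = (\<Prod>(i, j)\<in>pairs {..<length a}. order_sign (a ! i) (a ! j))"
    by (rule prod.reindex_bij_witness[of _ "\<lambda>(i, j). (Suc i, Suc j)" "\<lambda>(i, j). (i - 1, j - 1)"])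
      (auto simp: pairs_def p_def)
  finally show ?thesis using True by (auto simp: seq_sgn_def p_def)
qed (auto simp: seq_sgn_def)

section \<open>The sign of one word relative to another\<close>

definition positions :: "nat list \<Rightarrow> nat \<Rightarrow> nat list" where
  "positions s c = filter (\<lambda>b. s ! b = c) [0..<length s]"

lemma set_positions: "set (positions s c) = {b. b < length s \<and> s ! b = c}"
  by (auto simp: positions_def)

lemma sorted_positions: "sorted (positions s c)" "distinct (positions s c)"
  by (auto simp: positions_def sorted_wrt_filter)

lemma length_positions: "length (positions s c) = count_list s c"
proof -
  have "count_list s c = length (filter ((=) c) (map ((!) s) [0..<length s]))"
    by (simp add: map_nth count_list_eq_length_filter)
  also have "filter ((=) c) (map ((!) s) [0..<length s]) = map ((!) s) (positions s c)"
    unfolding positions_def filter_map o_def by (intro arg_cong[of _ _ "map _"] filter_cong) auto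
  finally show ?thesis by simp
qed

text \<open>Each factor of \<open>sgn_word\<close> compares positions with the same letter of
  \<open>s\<close>, and such a pair of positions belongs to exactly one letter. Hence the factors
  merge into one product over pairs. The condition says that no factor is zero.\<close>

lemma sgn_word_eq_prod_pairs:
  "sgn_word s x = (if \<forall>c\<in>set s. distinct (map ((!) x) (positions s c)) \<and>
         set (map ((!) x) (positions s c)) = {1..count_list s c}
     then \<Prod>(i, j)\<in>pairs {..<length s}. if s ! i = s ! j then order_sign (x ! i) (x ! j) else 1
     else 0)" (is "_ = (if \<forall>c\<in>set s. ?V c then _ else 0)")
proof (cases "\<forall>c\<in>set s. ?V c")
  case True
  define G where "G = (\<lambda>(i, j). order_sign (x ! i) (x ! j))"
  have "sgn_word s x = (\<Prod>c\<in>set s. \<Prod>p\<in>pairs (set (positions s c)). G p)"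
    unfolding sgn_word_def positions_def[symmetric]
  proof (intro prod.cong refl)
    fix c assume "c \<in> set s"
    with True have "seq_sgn (map ((!) x) (positions s c)) =
       (\<Prod>(i, j)\<in>pairs {..<length (positions s c)}. order_sign (x ! (positions s c ! i)) (x ! (positions s c ! j)))"
      by (auto simp: seq_sgn_eq_prod_pairs length_positions pairs_def intro!: prod.cong)
    also have "\<dots> = (\<Prod>p\<in>pairs (set (positions s c)). G p)"
      unfolding G_def
      by (rule prod_pairs_mono_reindex[of "positions s c" "\<lambda>i j. order_sign (x ! i) (x ! j)"])
        (rule sorted_positions)+
    finally show "seq_sgn (map ((!) x) (positions s c)) = (\<Prod>p\<in>pairs (set (positions s c)). G p)" .
  qed
  also have "\<dots> = (\<Prod>p\<in>(\<Union>c\<in>set s. pairs (set (positions s c))). G p)"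
    by (rule prod.UNION_disjoint[symmetric])
      (simp_all, auto simp: pairs_def set_positions)
  also have "(\<Union>c\<in>set s. pairs (set (positions s c))) = {(i, j) \<in> pairs {..<length s}. s ! i = s ! j}"
    by (auto simp: pairs_def set_positions)
  also have "(\<Prod>p\<in>\<dots>. G p) = (\<Prod>p\<in>pairs {..<length s}. if s ! fst p = s ! snd p then G p else 1)"
    by (subst prod.inter_filter[symmetric]) (auto intro!: prod.cong)
  finally show ?thesis using True by (auto simp: G_def case_prod_unfold intro!: prod.cong)
next
  case False
  then obtain c where "c \<in> set s" "\<not> ?V c" by blast
  then have "sgn_word s x = 0"
    unfolding sgn_word_def positions_def[symmetric]
    by (intro prod_zero bexI[of _ c]) (auto simp: seq_sgn_def length_positions)
  then show ?thesis using False by auto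
qed

subsection \<open>Words and the grid of letters\<close>

lemma words_replicate_iff:
  "w \<in> words (replicate k n) \<longleftrightarrow>
     length w = k * n \<and> set w \<subseteq> {1..k} \<and> (\<forall>c\<in>{1..k}. count_list w c = n)"
proof -
  have "(\<forall>i<k. count_list w (Suc i) = n) \<longleftrightarrow> (\<forall>c\<in>{1..k}. count_list w c = n)"
    by (auto simp: Ball_def) (metis Suc_le_D Suc_le_mono less_eq_Suc_le old.nat.exhaust)
  then show ?thesis by (auto simp: words_def sum_list_replicate)
qed

text \<open>For words with the right letter counts, this is the condition for the relative sign to
  be nonzero, in a form that treats both words alike.\<close>

definition grid_bij :: "nat \<Rightarrow> nat \<Rightarrow> nat list \<Rightarrow> nat list \<Rightarrow> bool" where
  "grid_bij k n s x \<longleftrightarrow> bij_betw (\<lambda>i. (s ! i, x ! i)) {..<k * n} ({1..k} \<times> {1..n})"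

lemma grid_bij_swap: "grid_bij k n s x \<longleftrightarrow> grid_bij n k x s"
proof -
  have "grid_bij n k x s" if "grid_bij k n s x" for k n s x
  proof -
    have "bij_betw prod.swap ({1..k} \<times> {1..n}) ({1..n} \<times> {1..k})"
      by (rule bij_betw_byWitness[of _ prod.swap]) auto
    from bij_betw_trans[OF that[unfolded grid_bij_def] this]
    show ?thesis by (simp add: grid_bij_def o_def mult.commute)
  qed
  then show ?thesis by blast
qed

text \<open>Row \<open>c\<close> of the grid has \<open>n\<close> points, so the letter
  \<open>c\<close> occurs at exactly \<open>n\<close> positions of \<open>s\<close>.\<close>

lemma grid_bij_imp_words:
  assumes "grid_bij k n s x" "length s = k * n"
  shows "s \<in> words (replicate k n)"
proof -
  have inj: "inj_on (\<lambda>i. (s ! i, x ! i)) {..<k * n}"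
    and im: "(\<lambda>i. (s ! i, x ! i)) ` {..<k * n} = {1..k} \<times> {1..n}"
    using assms(1) by (auto simp: grid_bij_def bij_betw_def)
  have "s ! i \<in> {1..k}" if "i < k * n" for i
    using im that by (metis (no_types, lifting) SigmaD1 imageI lessThan_iff)
  then have "set s \<subseteq> {1..k}" using assms(2) by (auto simp: in_set_conv_nth simp del: atLeastAtMost_iff)
  moreover have "count_list s c = n" if c: "c \<in> {1..k}" for c
  proof -
    have "(\<lambda>i. (s ! i, x ! i)) ` set (positions s c) = {c} \<times> {1..n}"
    proof (intro equalityI subsetI)
      fix p assume p: "p \<in> {c} \<times> {1..n}"
      then have "p \<in> (\<lambda>i. (s ! i, x ! i)) ` {..<k * n}" using im c by auto
      then show "p \<in> (\<lambda>i. (s ! i, x ! i)) ` set (positions s c)"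
        using p assms(2) by (auto simp: set_positions)
    next
      fix p assume "p \<in> (\<lambda>i. (s ! i, x ! i)) ` set (positions s c)"
      then obtain i where i: "i < k * n" "s ! i = c" "p = (s ! i, x ! i)"
        using assms(2) by (auto simp: set_positions)
      then have "p \<in> {1..k} \<times> {1..n}" using im by blast
      then show "p \<in> {c} \<times> {1..n}" using i by auto
    qed
    moreover have "inj_on (\<lambda>i. (s ! i, x ! i)) (set (positions s c))"
      using inj assms(2) by (rule_tac inj_on_subset) (auto simp: set_positions)
    ultimately have "card (set (positions s c)) = card ({c} \<times> {1..n})"
      by (metis card_image)
    then show ?thesis
      by (simp add: card_cartesian_product distinct_card sorted_positions length_positions)
  qed
  ultimately show ?thesis using assms(2) by (simp add: words_replicate_iff)
qed

lemma set_words: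
  assumes "s \<in> words (replicate k n)" "n \<ge> 1"
  shows "set s = {1..k}"
  using assms unfolding words_replicate_iff
  by (metis count_list_0_iff not_one_le_zero subsetI subset_antisym)

text \<open>Since every letter of \<open>s\<close> occurs \<open>n\<close> times, having a
  permutation of \<open>{1..n}\<close> at the positions of each letter amounts to hitting every grid
  point once.\<close>

lemma sgn_word_grid:
  assumes s: "s \<in> words (replicate k n)" and n: "n \<ge> 1"
  shows "sgn_word s x = (if grid_bij k n s x
     then \<Prod>(i, j)\<in>pairs {..<k * n}. if s ! i = s ! j then order_sign (x ! i) (x ! j) else 1
     else 0)"
proof -
  have len: "length s = k * n" and cnt: "\<And>c. c \<in> {1..k} \<Longrightarrow> count_list s c = n"
    using s by (auto simp: words_replicate_iff)
  note set_s = set_words[OF s n]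
  have "(\<forall>c\<in>set s. distinct (map ((!) x) (positions s c)) \<and>
         set (map ((!) x) (positions s c)) = {1..count_list s c}) \<longleftrightarrow> grid_bij k n s x"
    (is "?V \<longleftrightarrow> _")
  proof
    assume V: ?V
    have inj: "inj_on ((!) x) {b. b < k * n \<and> s ! b = c}"
      and im: "(!) x ` {b. b < k * n \<and> s ! b = c} = {1..n}" if "c \<in> {1..k}" for c
      using V that cnt[OF that] by (auto simp: set_s distinct_map set_positions len)
    have sk: "s ! i \<in> {1..k}" if "i < k * n" for i
      using that len set_s nth_mem by metis
    have inj2: "inj_on (\<lambda>i. (s ! i, x ! i)) {..<k * n}"
    proof (rule inj_onI)
      fix i j assume "i \<in> {..<k * n}" "j \<in> {..<k * n}" "(s ! i, x ! i) = (s ! j, x ! j)"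
      then show "i = j" using inj_onD[OF inj[OF sk[of i]], of i j] by auto
    qed
    moreover have "(\<lambda>i. (s ! i, x ! i)) ` {..<k * n} = {1..k} \<times> {1..n}"
    proof (rule card_subset_eq)
      show "(\<lambda>i. (s ! i, x ! i)) ` {..<k * n} \<subseteq> {1..k} \<times> {1..n}"
        using im[OF sk] sk by auto
      show "card ((\<lambda>i. (s ! i, x ! i)) ` {..<k * n}) = card ({1..k} \<times> {1..n})"
        by (simp add: card_image[OF inj2] card_cartesian_product)
    qed simp
    ultimately show "grid_bij k n s x" by (simp add: grid_bij_def bij_betw_def)
  next
    assume "grid_bij k n s x"
    then have inj: "inj_on (\<lambda>i. (s ! i, x ! i)) {..<k * n}"
      and im: "(\<lambda>i. (s ! i, x ! i)) ` {..<k * n} = {1..k} \<times> {1..n}"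
      by (auto simp: grid_bij_def bij_betw_def)
    show ?V
    proof (rule ballI)
      fix c assume "c \<in> set s"
      then have c: "c \<in> {1..k}" by (simp only: set_s)
      have "inj_on ((!) x) {b. b < k * n \<and> s ! b = c}"
        using inj by (auto simp: inj_on_def)
      moreover have "(!) x ` {b. b < k * n \<and> s ! b = c} = {1..n}"
      proof (intro equalityI subsetI)
        fix y assume "y \<in> {1..n}"
        then have "(c, y) \<in> (\<lambda>i. (s ! i, x ! i)) ` {..<k * n}" using im c by auto
        then show "y \<in> (!) x ` {b. b < k * n \<and> s ! b = c}" by auto
      next
        fix y assume "y \<in> (!) x ` {b. b < k * n \<and> s ! b = c}"
        then have "(c, y) \<in> (\<lambda>i. (s ! i, x ! i)) ` {..<k * n}" by auto
        then show "y \<in> {1..n}" unfolding im by auto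
      qed
      ultimately show "distinct (map ((!) x) (positions s c)) \<and>
          set (map ((!) x) (positions s c)) = {1..count_list s c}"
        using cnt[OF c] by (simp add: distinct_map set_positions len sorted_positions)
    qed
  qed
  then show ?thesis unfolding sgn_word_eq_prod_pairs len by simp
qed

section \<open>Exchanging the roles of two words\<close>

lemma word_sign_eq_prod_pairs:
  "word_sign s = (\<Prod>(i, j)\<in>pairs {..<length s}. order_sign (s ! i) (s ! j))"
proof -
  have "(\<Prod>(i, j)\<in>pairs {..<length s}. order_sign (s ! i) (s ! j))
      = (\<Prod>p\<in>pairs {..<length s}. if s ! fst p > s ! snd p then - 1 else (1::int))"
    by (intro prod.cong) (auto simp: order_sign_def)
  also have "\<dots> = (\<Prod>p\<in>{p \<in> pairs {..<length s}. s ! fst p > s ! snd p}. - 1)"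
    by (rule prod.inter_filter[symmetric]) simp
  also have "{p \<in> pairs {..<length s}. s ! fst p > s ! snd p}
      = {(i, j). i < j \<and> j < length s \<and> s ! i > s ! j}"
    by (auto simp: pairs_def)
  finally show ?thesis by (simp add: word_sign_def)
qed

text \<open>A pair of grid points contributes -1 exactly when the row-by-row order and the
  column-by-column order of the grid disagree on it.\<close>

definition grid_sign :: "nat \<Rightarrow> nat \<Rightarrow> int" where
  "grid_sign k n = (\<Prod>(p, q)\<in>pairs ({1..k} \<times> {1..n}).
     if fst p = fst q \<or> snd p = snd q then 1
     else order_sign (fst p) (fst q) * order_sign (snd p) (snd q))"

text \<open>
  Up to the sign of \<open>x\<close>, both sides are the sign of the bijection from positions to grid
  points; one orders the grid by rows, the other by columns. The two orders disagree on a
  number of pairs of grid points that does not depend on \<open>s\<close> and \<open>x\<close>.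
\<close>

lemma word_sign_mult_sgn_word:
  assumes g: "grid_bij k n s x" and len: "length s = k * n" "length x = k * n"
    and kn: "k \<ge> 1" "n \<ge> 1"
  shows "word_sign s * sgn_word s x = grid_sign k n * word_sign x * sgn_word x s"
proof -
  define c where "c = (\<lambda>p q :: nat \<times> nat. if fst p = fst q \<or> snd p = snd q then 1
    else order_sign (fst p) (fst q) * order_sign (snd p) (snd q))"
  have g': "grid_bij n k x s" using g grid_bij_swap by blast
  have inj: "inj_on (\<lambda>i. (s ! i, x ! i)) {..<k * n}"
    using g by (simp add: grid_bij_def bij_betw_def)
  have "grid_sign k n = (\<Prod>(p, q)\<in>pairs ({1..k} \<times> {1..n}). c p q)"
    by (simp add: grid_sign_def c_def)
  \<comment> \<open>\<open>c\<close> is symmetric because both order signs flip together, so the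
    product can be moved from grid points to positions.\<close>
  also have "\<dots> = (\<Prod>(i, j)\<in>pairs {..<k * n}. c (s ! i, x ! i) (s ! j, x ! j))"
    using g unfolding grid_bij_def
    by (intro prod_pairs_reindex[symmetric]) (auto simp: c_def order_sign_def)
  finally have gs: "grid_sign k n = (\<Prod>(i, j)\<in>pairs {..<k * n}. c (s ! i, x ! i) (s ! j, x ! j))" .
  have s: "s \<in> words (replicate k n)" using grid_bij_imp_words[OF g] len by simp
  have x: "x \<in> words (replicate n k)" using grid_bij_imp_words[OF g'] len by (simp add: mult.commute)
  have "word_sign s * sgn_word s x = (\<Prod>(i, j)\<in>pairs {..<k * n}.
      order_sign (s ! i) (s ! j) * (if s ! i = s ! j then order_sign (x ! i) (x ! j) else 1))"
    using g len by (simp add: word_sign_eq_prod_pairs sgn_word_grid[OF s kn(2)] prod.distrib case_prod_unfold)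
  also have "\<dots> = (\<Prod>(i, j)\<in>pairs {..<k * n}. c (s ! i, x ! i) (s ! j, x ! j) *
      order_sign (x ! i) (x ! j) * (if x ! i = x ! j then order_sign (s ! i) (s ! j) else 1))"
  proof (intro prod.cong refl, clarify)
    fix i j assume "(i, j) \<in> pairs {..<k * n}"
    then have "(s ! i, x ! i) \<noteq> (s ! j, x ! j)"
      using inj_onD[OF inj, of i j] by (auto simp: pairs_def)
    then show "order_sign (s ! i) (s ! j) * (if s ! i = s ! j then order_sign (x ! i) (x ! j) else 1)
      = c (s ! i, x ! i) (s ! j, x ! j) * order_sign (x ! i) (x ! j) *
        (if x ! i = x ! j then order_sign (s ! i) (s ! j) else 1)"
      by (auto simp: c_def order_sign_def)
  qed
  also have "\<dots> = grid_sign k n * word_sign x * sgn_word x s"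
    using g' len by (simp add: gs word_sign_eq_prod_pairs sgn_word_grid[OF x kn(1)] prod.distrib
        case_prod_unfold mult.commute[of n k])
  finally show ?thesis .
qed

lemma grid_sign_square: "grid_sign k n * grid_sign k n = 1"
  unfolding grid_sign_def prod.distrib[symmetric]
  by (rule prod.neutral) (auto simp: order_sign_def)

lemma word_sign_square: "word_sign w * word_sign w = 1"
  by (simp add: word_sign_def power_add[symmetric])

lemma prod_list_map_eq_prod_nth: "prod_list (map f xs) = (\<Prod>i<length xs. f (xs ! i))"
  by (simp add: prod.list_conv_set_nth atLeast0LessThan)

text \<open>In each row, exchanging the two words costs the factor
  \<open>grid_sign k n * word_sign x\<close>, which does not depend on the row. For even
  \<open>d\<close> these factors multiply to 1.\<close>

lemma sgn_table_transpose:
  assumes len: "length S = d" and S: "\<And>s. s \<in> set S \<Longrightarrow> s \<in> words (replicate k n)"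
    and d: "even d" and x: "x \<in> words (replicate n k)" and kn: "k \<ge> 1" "n \<ge> 1"
  shows "table_sign S * sgn_table S (replicate d x) = sgn_table (replicate d x) S"
proof -
  have ts: "table_sign S * sgn_table S (replicate d x)
      = (\<Prod>l<d. word_sign (S ! l) * sgn_word (S ! l) x)"
    by (simp add: table_sign_def sgn_table_def prod_list_map_eq_prod_nth len prod.distrib)
  have st: "sgn_table (replicate d x) S = (\<Prod>l<d. sgn_word x (S ! l))"
    by (simp add: sgn_table_def)
  have Sl: "S ! l \<in> words (replicate k n)" if "l < d" for l using S len that by simp
  show ?thesis
  proof (cases "\<forall>l<d. grid_bij k n (S ! l) x")
    case True
    have "(\<Prod>l<d. word_sign (S ! l) * sgn_word (S ! l) x)
        = (\<Prod>l<d. (grid_sign k n * word_sign x) * sgn_word x (S ! l))"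
    proof (intro prod.cong refl)
      fix l assume "l \<in> {..<d}"
      then show "word_sign (S ! l) * sgn_word (S ! l) x = grid_sign k n * word_sign x * sgn_word x (S ! l)"
        using True Sl x kn by (intro word_sign_mult_sgn_word) (auto simp: words_replicate_iff)
    qed
    also have "\<dots> = (grid_sign k n * word_sign x) ^ d * (\<Prod>l<d. sgn_word x (S ! l))"
      unfolding prod.distrib[of "\<lambda>_. grid_sign k n * word_sign x"] by simp
    also have "(grid_sign k n * word_sign x) ^ d = 1"
    proof -
      have "(grid_sign k n * word_sign x)\<^sup>2 = 1"
        by (simp add: power2_eq_square mult.assoc mult.left_commute[of "word_sign x"]
            word_sign_square grid_sign_square)
      then show ?thesis using d by (metis evenE power_mult power_one)
    qed
    finally show ?thesis using ts st by simp
  next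
    case False
    then obtain l where l: "l < d" "\<not> grid_bij k n (S ! l) x" by blast
    then have "sgn_word (S ! l) x = 0" "sgn_word x (S ! l) = 0"
      using sgn_word_grid[OF Sl kn(2)] sgn_word_grid[OF x kn(1)] grid_bij_swap by auto
    then have "(\<Prod>l<d. word_sign (S ! l) * sgn_word (S ! l) x) = 0" "(\<Prod>l<d. sgn_word x (S ! l)) = 0"
      using l by (auto intro!: prod_zero bexI[of _ l])
    then show ?thesis by (simp only: ts st)
  qed
qed

text \<open>The first row already forces the grid condition on \<open>x\<close>. This will restrict
  sums over all words to words with the right letter counts.\<close>

lemma sgn_table_nonzero_words:
  assumes "length S = d" "\<And>s. s \<in> set S \<Longrightarrow> s \<in> words (replicate k n)"
    and "d \<ge> 1" "n \<ge> 1" "length x = k * n" "sgn_table S (replicate d x) \<noteq> 0"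
  shows "x \<in> words (replicate n k)"
proof -
  have s: "S ! 0 \<in> words (replicate k n)" using assms by (intro assms(2) nth_mem) auto
  have "sgn_word (S ! 0) x \<noteq> 0"
    using assms by (auto simp: sgn_table_def Suc_le_eq)
  then have "grid_bij k n (S ! 0) x" using sgn_word_grid[OF s] assms by (auto split: if_splits)
  then have "grid_bij n k x (S ! 0)" using grid_bij_swap by blast
  then show ?thesis using assms by (intro grid_bij_imp_words) (auto simp: mult.commute)
qed

text \<open>The counterpart for tables: the grid condition holds in every row, hence tables with a
  row of wrong letter counts drop out of the expansion.\<close>

lemma sgn_table_replicate_nonzero_words:
  assumes "length T = d" "\<And>t. t \<in> set T \<Longrightarrow> length t = n * k"
    and "k \<ge> 1" "w \<in> words (replicate n k)" "sgn_table (replicate d w) T \<noteq> 0" "t \<in> set T"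
  shows "t \<in> words (replicate k n)"
proof -
  obtain l where l: "l < d" "t = T ! l" using assms by (auto simp: in_set_conv_nth)
  have "sgn_word w t \<noteq> 0"
    using assms(1,5) l by (auto simp: sgn_table_def)
  then have "grid_bij n k w t" using sgn_word_grid[OF assms(4,3)] by (auto split: if_splits)
  then have "grid_bij k n t w" using grid_bij_swap by blast
  then show ?thesis using assms by (intro grid_bij_imp_words) (auto simp: mult.commute)
qed

section \<open>Simultaneous permutation of the positions\<close>

lemma words_cong_mset:
  assumes "mset w = mset w'"
  shows "w \<in> words \<alpha> \<longleftrightarrow> w' \<in> words \<alpha>"
  using assms mset_eq_length[OF assms] mset_eq_setD[OF assms]
  by (simp add: words_def flip: count_mset)

lemma grid_bij_permute:
  assumes "\<sigma> permutes {..<k * n}" "length s = k * n" "length x = k * n"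
  shows "grid_bij k n (permute_list \<sigma> s) (permute_list \<sigma> x) \<longleftrightarrow> grid_bij k n s x"
proof -
  have "grid_bij k n (permute_list \<sigma> s) (permute_list \<sigma> x) \<longleftrightarrow>
      bij_betw ((\<lambda>i. (s ! i, x ! i)) \<circ> \<sigma>) {..<k * n} ({1..k} \<times> {1..n})"
    unfolding grid_bij_def
    using assms by (intro bij_betw_cong) (auto simp: permute_list_nth)
  then show ?thesis
    using bij_betw_comp_iff[OF permutes_imp_bij[OF assms(1)]] unfolding grid_bij_def by blast
qed

text \<open>
  Evenness of \<open>d\<close> makes the product of the \<open>d\<close> order signs of a pair of positions symmetric,
  hence independent of how the positions are ordered.
\<close>

lemma sgn_table_permute:
  assumes \<sigma>: "\<sigma> permutes {..<n * k}" and w: "w \<in> words (replicate n k)"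
    and T: "length T = d" "\<And>t. t \<in> set T \<Longrightarrow> length t = n * k"
    and d: "even d" and k: "k \<ge> 1"
  shows "sgn_table (replicate d (permute_list \<sigma> w)) (map (permute_list \<sigma>) T) = sgn_table (replicate d w) T"
proof -
  have lw: "length w = n * k" using w by (simp add: words_replicate_iff)
  have Tl: "length (T ! l) = n * k" if "l < d" for l using T that by simp
  have w': "permute_list \<sigma> w \<in> words (replicate n k)"
    using w \<sigma> lw by (subst words_cong_mset[of _ w]) auto
  have grid: "grid_bij n k (permute_list \<sigma> w) (permute_list \<sigma> (T ! l)) \<longleftrightarrow> grid_bij n k w (T ! l)"
    if "l < d" for l using grid_bij_permute[OF \<sigma> lw Tl[OF that]] .
  have L: "sgn_table (replicate d (permute_list \<sigma> w)) (map (permute_list \<sigma>) T)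
      = (\<Prod>l<d. sgn_word (permute_list \<sigma> w) (permute_list \<sigma> (T ! l)))"
    by (simp add: sgn_table_def T)
  have R: "sgn_table (replicate d w) T = (\<Prod>l<d. sgn_word w (T ! l))"
    by (simp add: sgn_table_def)
  show ?thesis
  proof (cases "\<forall>l<d. grid_bij n k w (T ! l)")
    case True
    \<comment> \<open>\<open>g i j\<close> collects the contributions of one pair of positions from
      all rows.\<close>
    define g where "g = (\<lambda>i j. \<Prod>l<d. if w ! i = w ! j then order_sign (T ! l ! i) (T ! l ! j) else 1)"
    have sym: "g i j = g j i" if ij: "i < n * k" "j < n * k" "i \<noteq> j" for i j
    proof (cases "w ! i = w ! j")
      case eq: True
      \<comment> \<open>Positions with the same letter of \<open>w\<close> carry different letters
        in every row of \<open>T\<close>, so each of the \<open>d\<close> order signs really flips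
        when \<open>i\<close> and \<open>j\<close> are exchanged.\<close>
      have "T ! l ! j \<noteq> T ! l ! i" if "l < d" for l
      proof -
        have "inj_on (\<lambda>i. (w ! i, T ! l ! i)) {..<n * k}"
          using True that by (auto simp: grid_bij_def bij_betw_def)
        from inj_onD[OF this, of i j] show ?thesis using ij eq by auto
      qed
      then have "g i j = (\<Prod>l<d. - 1 * order_sign (T ! l ! j) (T ! l ! i))"
        using eq by (auto simp: g_def intro!: prod.cong order_sign_swap)
      also have "\<dots> = g j i" unfolding prod.distrib using eq d by (simp add: g_def)
      finally show ?thesis .
    qed (simp add: g_def)
    have "(\<Prod>l<d. sgn_word (permute_list \<sigma> w) (permute_list \<sigma> (T ! l)))
        = (\<Prod>l<d. \<Prod>(i, j)\<in>pairs {..<n * k}. if w ! \<sigma> i = w ! \<sigma> j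
             then order_sign (T ! l ! \<sigma> i) (T ! l ! \<sigma> j) else 1)"
      using True grid \<sigma> lw Tl
      by (auto simp: sgn_word_grid[OF w' k] pairs_def permute_list_nth intro!: prod.cong)
    also have "\<dots> = (\<Prod>(i, j)\<in>pairs {..<n * k}. g (\<sigma> i) (\<sigma> j))"
      unfolding g_def case_prod_unfold by (rule prod.swap)
    also have "\<dots> = (\<Prod>(i, j)\<in>pairs {..<n * k}. g i j)"
      using sym by (intro prod_pairs_reindex permutes_imp_bij \<sigma>) auto
    also have "\<dots> = (\<Prod>l<d. sgn_word w (T ! l))"
      using True unfolding g_def case_prod_unfold
      by (subst prod.swap) (auto simp: sgn_word_grid[OF w k] case_prod_unfold intro!: prod.cong)
    finally show ?thesis unfolding L R .
  next
    case False
    then obtain l where l: "l < d" "\<not> grid_bij n k w (T ! l)" by blast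
    then have "sgn_word w (T ! l) = 0" "sgn_word (permute_list \<sigma> w) (permute_list \<sigma> (T ! l)) = 0"
      using grid by (auto simp: sgn_word_grid[OF w k] sgn_word_grid[OF w' k])
    then show ?thesis
      unfolding L R using l by (metis finite_lessThan lessThan_iff prod_zero)
  qed
qed

subsection \<open>Sums over tables\<close>

lemma finite_all_tables: "finite (all_tables d m n)"
proof -
  have "finite {x. set x \<subseteq> {1..n} \<and> length x = m}" by (rule finite_lists_length_eq) simp
  then have "finite {X. set X \<subseteq> {x. set x \<subseteq> {1..n} \<and> length x = m} \<and> length X = d}"
    by (rule finite_lists_length_eq)
  then show ?thesis by (rule rev_finite_subset) (auto simp: all_tables_def)
qed

lemma all_tables_hd:
  assumes "T \<in> all_tables d m n" "d \<ge> 1"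
  shows "length (hd T) = m"
proof -
  have "T \<noteq> []" using assms by (auto simp: all_tables_def)
  then show ?thesis using assms by (auto simp: all_tables_def)
qed

lemma columns_all_tables:
  assumes "T \<in> all_tables d m n" "d \<ge> 1"
  shows "columns T = map (\<lambda>j. map (\<lambda>t. t ! j) T) [0..<m]"
  using all_tables_hd[OF assms] by (simp add: columns_def)

lemma vee_cong_mset: "mset (columns S) = mset (columns T) \<Longrightarrow> vee S = vee T"
  unfolding vee_def by (metis mset_map prod_mset_prod_list)

lemma permute_list_inverse:
  assumes "\<sigma> permutes {..<length x}"
  shows "permute_list (inv \<sigma>) (permute_list \<sigma> x) = x"
  using permute_list_compose[OF permutes_inv[OF assms], of \<sigma>] permutes_inv_o[OF assms] by simp

lemma map_permute_list_in_all_tables: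
  assumes "\<sigma> permutes {..<m}" "T \<in> all_tables d m n"
  shows "map (permute_list \<sigma>) T \<in> all_tables d m n"
proof -
  have "set (permute_list \<sigma> x) = set x" if "length x = m" for x :: "nat list"
    using assms(1) that by simp
  then show ?thesis using assms(2) by (auto simp: all_tables_def)
qed

lemma map_permute_list_inverse:
  assumes "\<sigma> permutes {..<m}" "T \<in> all_tables d m n"
  shows "map (permute_list (inv \<sigma>)) (map (permute_list \<sigma>) T) = T"
proof -
  have "map (\<lambda>t. permute_list (inv \<sigma>) (permute_list \<sigma> t)) T = map (\<lambda>t. t) T"
    using assms by (intro map_cong refl permute_list_inverse) (auto simp: all_tables_def)
  then show ?thesis by (simp add: o_def)
qed

lemma bij_betw_map_permute_list:
  assumes \<sigma>: "\<sigma> permutes {..<m}"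
  shows "bij_betw (map (permute_list \<sigma>)) (all_tables d m n) (all_tables d m n)"
proof (rule bij_betw_byWitness[of _ "map (permute_list (inv \<sigma>))"])
  show "\<forall>T\<in>all_tables d m n. map (permute_list (inv \<sigma>)) (map (permute_list \<sigma>) T) = T"
    using map_permute_list_inverse[OF \<sigma>] by blast
  show "\<forall>T\<in>all_tables d m n. map (permute_list \<sigma>) (map (permute_list (inv \<sigma>)) T) = T"
    using map_permute_list_inverse[OF permutes_inv[OF \<sigma>]] permutes_inv_inv[OF \<sigma>] by metis
  show "map (permute_list \<sigma>) ` all_tables d m n \<subseteq> all_tables d m n"
    using map_permute_list_in_all_tables[OF \<sigma>] by blast
  show "map (permute_list (inv \<sigma>)) ` all_tables d m n \<subseteq> all_tables d m n"
    using map_permute_list_in_all_tables[OF permutes_inv[OF \<sigma>]] by blast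
qed

lemma columns_permute:
  assumes \<sigma>: "\<sigma> permutes {..<m}" and T: "T \<in> all_tables d m n" and d: "d \<ge> 1"
  shows "columns (map (permute_list \<sigma>) T) = permute_list \<sigma> (columns T)"
proof (rule nth_equalityI)
  have T': "map (permute_list \<sigma>) T \<in> all_tables d m n" by (rule map_permute_list_in_all_tables[OF \<sigma> T])
  show "length (columns (map (permute_list \<sigma>) T)) = length (permute_list \<sigma> (columns T))"
    by (simp add: columns_all_tables[OF T' d] columns_all_tables[OF T d])
  fix j assume "j < length (columns (map (permute_list \<sigma>) T))"
  then have j: "j < m" by (simp add: columns_all_tables[OF T' d])
  then have sj: "\<sigma> j < m" using permutes_in_image[OF \<sigma>, of j] by simp
  have len: "length t = m" if "t \<in> set T" for t using T that by (auto simp: all_tables_def)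
  show "columns (map (permute_list \<sigma>) T) ! j = permute_list \<sigma> (columns T) ! j"
    using j sj \<sigma> len
    by (simp add: columns_all_tables[OF T' d] columns_all_tables[OF T d] permute_list_nth)
qed

lemma vee_permute:
  assumes \<sigma>: "\<sigma> permutes {..<m}" and T: "T \<in> all_tables d m n" and d: "d \<ge> 1"
  shows "vee (map (permute_list \<sigma>) T) = vee T"
  using \<sigma> by (intro vee_cong_mset) (simp add: columns_permute[OF assms] columns_all_tables[OF T d])

text \<open>The sum \<open>Z(w)\<close> of the introduction; the number of columns is read off from
  \<open>w\<close>.\<close>

definition word_sum :: "nat \<Rightarrow> nat \<Rightarrow> nat list \<Rightarrow> tensor_poly" where
  "word_sum d k w = (\<Sum>T\<in>all_tables d (length w) k. of_int (sgn_table (replicate d w) T) * vee T)"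

text \<open>The two words differ by a permutation of positions. Applying it to the tables as well
  changes neither signs nor monomials and only reindexes the sum.\<close>

lemma word_sum_cong_mset:
  assumes w: "w \<in> words (replicate n k)" and eq: "mset w' = mset w"
    and d: "even d" "d \<ge> 1" and k: "k \<ge> 1"
  shows "word_sum d k w' = word_sum d k w"
proof -
  obtain \<sigma> where "\<sigma> permutes {..<length w}" "permute_list \<sigma> w = w'"
    using mset_eq_permutation[OF eq] by auto
  moreover have len: "length w = n * k" using w by (simp add: words_replicate_iff)
  ultimately have \<sigma>: "\<sigma> permutes {..<n * k}" "w' = permute_list \<sigma> w" by auto
  have len': "length w' = n * k" using \<sigma> len by simp
  have "word_sum d k w' = (\<Sum>T\<in>all_tables d (n * k) k.
      of_int (sgn_table (replicate d w') (map (permute_list \<sigma>) T)) * vee (map (permute_list \<sigma>) T))"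
    unfolding word_sum_def len' by (rule sum.reindex_bij_betw[OF bij_betw_map_permute_list[OF \<sigma>(1)], symmetric])
  also have "\<dots> = word_sum d k w"
    unfolding word_sum_def len \<sigma>(2)
    using sgn_table_permute[OF \<sigma>(1) w _ _ d(1) k] vee_permute[OF \<sigma>(1) _ d(2)]
    by (intro sum.cong refl) (auto simp: all_tables_def)
  finally show ?thesis .
qed

section \<open>Concatenation of words and tables\<close>

lemma upt_add_split: "[0..<a + b] = [0..<a] @ map (\<lambda>i. i + a) [0..<b]"
  using upt_add_eq_append[of 0 a b] map_add_upt[of a b] by (simp add: add.commute)

lemma positions_append:
  "positions (s @ s') c = positions s c @ map (\<lambda>i. i + length s) (positions s' c)"
proof -
  have upt: "[0..<length (s @ s')] = [0..<length s] @ map (\<lambda>i. i + length s) [0..<length s']"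
    by (simp add: upt_add_split)
  show ?thesis
    unfolding positions_def upt filter_append filter_map
    by (intro arg_cong2[of _ _ _ _ "(@)"] arg_cong[of _ _ "map _"] filter_cong) (auto simp: nth_append)
qed

lemma positions_eq_Nil: "c \<notin> set s \<Longrightarrow> positions s c = []"
  by (auto simp: positions_def filter_empty_conv)

text \<open>As the alphabets of \<open>s\<close> and \<open>s'\<close> are disjoint, the positions
  of each letter lie in one of the two parts, and the product over letters splits.\<close>

lemma sgn_word_append:
  assumes "length x = length s" "set s \<inter> set s' = {}"
  shows "sgn_word (s @ s') (x @ x') = sgn_word s x * sgn_word s' x'"
proof -
  have 1: "seq_sgn (map ((!) (x @ x')) (positions (s @ s') c)) = seq_sgn (map ((!) x) (positions s c))"
    if "c \<in> set s" for c
  proof -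
    have "positions s' c = []" using that assms by (intro positions_eq_Nil) auto
    then have "map ((!) (x @ x')) (positions (s @ s') c) = map ((!) x) (positions s c)"
      using assms(1) by (auto simp: positions_append set_positions nth_append)
    then show ?thesis by simp
  qed
  have 2: "seq_sgn (map ((!) (x @ x')) (positions (s @ s') c)) = seq_sgn (map ((!) x') (positions s' c))"
    if "c \<in> set s'" for c
  proof -
    have "positions s c = []" using that assms by (intro positions_eq_Nil) auto
    then have "map ((!) (x @ x')) (positions (s @ s') c) = map ((!) x') (positions s' c)"
      using assms(1) by (auto simp: positions_append nth_append)
    then show ?thesis by simp
  qed
  show ?thesis
    unfolding sgn_word_def positions_def[symmetric] set_append
    using assms(2) 1 2 by (subst prod.union_disjoint) auto
qed

lemma bij_betw_append_tables:
  "bij_betw (\<lambda>(T, T'). map2 (@) T T') (all_tables d m n \<times> all_tables d m' n) (all_tables d (m + m') n)"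
proof (rule bij_betw_byWitness[of _ "\<lambda>U. (map (take m) U, map (drop m) U)"])
  show "\<forall>p\<in>all_tables d m n \<times> all_tables d m' n. (\<lambda>U. (map (take m) U, map (drop m) U))
      (case p of (T, T') \<Rightarrow> map2 (@) T T') = p"
    by (auto simp: all_tables_def intro!: nth_equalityI)
  show "\<forall>U\<in>all_tables d (m + m') n. (case (map (take m) U, map (drop m) U) of (T, T') \<Rightarrow> map2 (@) T T') = U"
    by (auto simp: intro!: nth_equalityI)
  show "(\<lambda>(T, T'). map2 (@) T T') ` (all_tables d m n \<times> all_tables d m' n) \<subseteq> all_tables d (m + m') n"
  proof clarify
    fix T T' assume "T \<in> all_tables d m n" "T' \<in> all_tables d m' n"
    then have len: "length T = d" "length T' = d"
      and T: "\<And>l. l < d \<Longrightarrow> length (T ! l) = m \<and> set (T ! l) \<subseteq> {1..n}"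
        "\<And>l. l < d \<Longrightarrow> length (T' ! l) = m' \<and> set (T' ! l) \<subseteq> {1..n}"
      by (simp_all add: all_tables_def)
    then show "map2 (@) T T' \<in> all_tables d (m + m') n"
      unfolding all_tables_def by (simp add: all_set_conv_all_nth)
  qed
  show "(\<lambda>U. (map (take m) U, map (drop m) U)) ` all_tables d (m + m') n \<subseteq> all_tables d m n \<times> all_tables d m' n"
    by (auto simp: all_tables_def simp del: atLeastAtMost_iff dest!: in_set_takeD in_set_dropD) blast+
qed

lemma vee_append:
  assumes "T \<in> all_tables d m n" "T' \<in> all_tables d m' n" "d \<ge> 1"
  shows "vee (map2 (@) T T') = vee T * vee T'"
proof -
  have U: "map2 (@) T T' \<in> all_tables d (m + m') n"
    using bij_betw_append_tables[of d m n m'] assms(1,2) by (auto simp: bij_betw_def)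
  have len: "length T = d" "length T' = d" "\<And>l. l < d \<Longrightarrow> length (T ! l) = m"
    using assms by (auto simp: all_tables_def)
  have "columns (map2 (@) T T') = columns T @ columns T'"
    unfolding columns_all_tables[OF U assms(3)] columns_all_tables[OF assms(1,3)]
        columns_all_tables[OF assms(2,3)] upt_add_split map_append map_map o_def
    using len
    by (intro arg_cong2[of _ _ _ _ "(@)"] map_cong refl nth_equalityI) (auto simp: nth_append)
  then show ?thesis by (simp add: vee_def)
qed

text \<open>Cutting every table after the last position of \<open>w\<close> factors both its sign
  and its monomial.\<close>

lemma word_sum_append:
  assumes "set w \<inter> set w' = {}" "d \<ge> 1"
  shows "word_sum d k (w @ w') = word_sum d k w * word_sum d k w'"
proof -
  let ?A = "all_tables d (length w) k" and ?B = "all_tables d (length w') k"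
  have "word_sum d k (w @ w') = (\<Sum>p\<in>?A \<times> ?B.
      of_int (sgn_table (replicate d (w @ w')) (case p of (T, T') \<Rightarrow> map2 (@) T T')) *
      vee (case p of (T, T') \<Rightarrow> map2 (@) T T'))"
    unfolding word_sum_def length_append by (rule sum.reindex_bij_betw[OF bij_betw_append_tables, symmetric])
  also have "\<dots> = (\<Sum>(T, T')\<in>?A \<times> ?B. (of_int (sgn_table (replicate d w) T) * vee T) *
      (of_int (sgn_table (replicate d w') T') * vee T'))"
  proof (intro sum.cong refl, clarify)
    fix T T' assume T: "T \<in> ?A" "T' \<in> ?B"
    have "sgn_table (replicate d (w @ w')) (map2 (@) T T')
        = sgn_table (replicate d w) T * sgn_table (replicate d w') T'"
      unfolding sgn_table_def using T assms(1)
      by (auto simp: all_tables_def sgn_word_append simp flip: prod.distrib intro!: prod.cong)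
    then show "of_int (sgn_table (replicate d (w @ w')) (map2 (@) T T')) * vee (map2 (@) T T') =
        (of_int (sgn_table (replicate d w) T) * vee T) * (of_int (sgn_table (replicate d w') T') * vee T')"
      by (simp add: vee_append[OF T assms(2)] mult_ac)
  qed
  also have "\<dots> = word_sum d k w * word_sum d k w'"
    unfolding word_sum_def sum_product by (rule sum.cartesian_product[symmetric])
  finally show ?thesis .
qed

subsection \<open>Powers of the hyperdeterminant\<close>

text \<open>Turns the \<open>d\<close>-tuples of permutations in \<open>hyperdet\<close> into tables
  with \<open>d\<close> rows.\<close>

definition one_line :: "nat \<Rightarrow> (nat \<Rightarrow> nat) \<Rightarrow> nat list" where
  "one_line k \<pi> = map \<pi> [1..<Suc k]"

text \<open>The identity outside \<open>{1..k}\<close>, as \<open>permutes\<close> demands.\<close>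

definition of_one_line :: "nat \<Rightarrow> nat list \<Rightarrow> nat \<Rightarrow> nat" where
  "of_one_line k t = (\<lambda>i. if i \<in> {1..k} then t ! (i - 1) else i)"

lemma length_one_line [simp]: "length (one_line k \<pi>) = k"
  by (simp add: one_line_def)

lemma nth_one_line: "j < k \<Longrightarrow> one_line k \<pi> ! j = \<pi> (Suc j)"
  by (simp add: one_line_def del: upt_Suc)

lemma of_one_line_one_line:
  "\<pi> permutes {1..k} \<Longrightarrow> of_one_line k (one_line k \<pi>) = \<pi>"
  by (auto simp: of_one_line_def nth_one_line fun_eq_iff permutes_not_in simp del: One_nat_def)

lemma one_line_of_one_line: "length t = k \<Longrightarrow> one_line k (of_one_line k t) = t"
  by (rule nth_equalityI) (auto simp: nth_one_line of_one_line_def)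

lemma one_line_permutes:
  assumes "\<pi> permutes {1..k}"
  shows "distinct (one_line k \<pi>)" "set (one_line k \<pi>) = {1..k}"
  using permutes_inj_on[OF assms] permutes_image[OF assms]
  by (auto simp: one_line_def distinct_map atLeastLessThanSuc_atLeastAtMost simp del: upt_Suc)

lemma of_one_line_permutes:
  assumes "distinct t" "set t = {1..k}" "length t = k"
  shows "of_one_line k t permutes {1..k}"
proof (rule bij_imp_permutes)
  have "set (map (of_one_line k t) [1..<Suc k]) = {1..k}"
    using one_line_of_one_line[OF assms(3)] assms(2) by (simp add: one_line_def)
  moreover have "distinct (map (of_one_line k t) [1..<Suc k])"
    using one_line_of_one_line[OF assms(3)] assms(1) by (simp add: one_line_def)
  ultimately show "bij_betw (of_one_line k t) {1..k} {1..k}"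
    by (simp add: bij_betw_def distinct_map atLeastLessThanSuc_atLeastAtMost del: upt_Suc)
qed (auto simp: of_one_line_def)

lemma seq_sgn_one_line:
  assumes "\<pi> permutes {1..k}"
  shows "seq_sgn (one_line k \<pi>) = sign \<pi>"
  using one_line_permutes[OF assms] of_one_line_one_line[OF assms]
  by (simp add: seq_sgn_def of_one_line_def)

lemma sgn_word_replicate:
  assumes "k \<ge> 1" "length t = k"
  shows "sgn_word (replicate k a) t = seq_sgn t"
proof -
  have "positions (replicate k a) a = [0..<k]"
    by (auto simp: positions_def filter_id_conv)
  then have "map ((!) t) (positions (replicate k a) a) = t"
    using assms(2) map_nth by auto
  then show ?thesis
    using assms(1) unfolding sgn_word_def positions_def[symmetric] by (simp add: set_replicate_conv_if)
qed

lemma bij_betw_one_line_tables: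
  "bij_betw (map (one_line k)) {\<pi>s. length \<pi>s = d \<and> (\<forall>\<pi>\<in>set \<pi>s. \<pi> permutes {1..k})}
     {T \<in> all_tables d k k. \<forall>t\<in>set T. distinct t \<and> set t = {1..k}}"
  (is "bij_betw _ ?P ?T")
proof (rule bij_betw_byWitness[of _ "map (of_one_line k)"])
  show "\<forall>\<pi>s\<in>?P. map (of_one_line k) (map (one_line k) \<pi>s) = \<pi>s"
    by (auto simp: of_one_line_one_line map_idI)
  show "\<forall>T\<in>?T. map (one_line k) (map (of_one_line k) T) = T"
    by (auto simp: all_tables_def one_line_of_one_line map_idI)
  show "map (one_line k) ` ?P \<subseteq> ?T"
    using one_line_permutes by (fastforce simp: all_tables_def)
  show "map (of_one_line k) ` ?T \<subseteq> ?P"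
    using of_one_line_permutes by (auto simp: all_tables_def)
qed

text \<open>For a constant word the sign vanishes unless each row is a permutation of
  \<open>{1..k}\<close>. What remains is the sum in \<open>hyperdet\<close> without its factor
  \<open>1 / fact k\<close>.\<close>

lemma word_sum_replicate:
  assumes d: "d \<ge> 1" and k: "k \<ge> 1"
  shows "word_sum d k (replicate k a) = of_nat (fact k) * hyperdet d k"
proof -
  let ?P = "{\<pi>s. length \<pi>s = d \<and> (\<forall>\<pi>\<in>set \<pi>s. \<pi> permutes {1..k})}"
  let ?T = "{T \<in> all_tables d k k. \<forall>t\<in>set T. distinct t \<and> set t = {1..k}}"
  let ?f = "\<lambda>T. of_int (sgn_table (replicate d (replicate k a)) T) * vee T"
  have sg: "sgn_table (replicate d (replicate k a)) T = (\<Prod>l<d. seq_sgn (T ! l))"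
    if "T \<in> all_tables d k k" for T
    using that k by (auto simp: sgn_table_def sgn_word_replicate all_tables_def intro!: prod.cong)
  have "word_sum d k (replicate k a) = sum ?f ?T"
    unfolding word_sum_def length_replicate
  proof (rule sum.mono_neutral_right[OF finite_all_tables], blast, rule ballI)
    fix T assume "T \<in> all_tables d k k - ?T"
    then have T: "T \<in> all_tables d k k" "\<exists>t\<in>set T. \<not> (distinct t \<and> set t = {1..k})" by auto
    then obtain t where t: "t \<in> set T" "\<not> (distinct t \<and> set t = {1..k})" by blast
    then obtain l where "l < length T" "T ! l = t" by (meson in_set_conv_nth)
    then have l: "l < d" "\<not> (distinct (T ! l) \<and> set (T ! l) = {1..k})"
      using T(1) t(2) by (auto simp: all_tables_def)
    have "length (T ! l) = k" using T l by (auto simp: all_tables_def)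
    then have "seq_sgn (T ! l) = 0" using l by (auto simp: seq_sgn_def)
    then have "sgn_table (replicate d (replicate k a)) T = 0"
      unfolding sg[OF T(1)] using l by (intro prod_zero) auto
    then show "?f T = 0" by simp
  qed
  also have "\<dots> = (\<Sum>\<pi>s\<in>?P. ?f (map (one_line k) \<pi>s))"
    by (rule sum.reindex_bij_betw[OF bij_betw_one_line_tables, symmetric])
  also have "\<dots> = (\<Sum>\<pi>s\<in>?P. of_int (prod_list (map sign \<pi>s)) * (\<Prod>i\<in>{1..k}. evar (map (\<lambda>\<pi>. \<pi> i) \<pi>s)))"
  proof (rule sum.cong[OF refl])
    fix \<pi>s assume P: "\<pi>s \<in> ?P"
    then have T: "map (one_line k) \<pi>s \<in> all_tables d k k"
      using bij_betw_one_line_tables[of k d] unfolding bij_betw_def by blast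
    have "sgn_table (replicate d (replicate k a)) (map (one_line k) \<pi>s) = prod_list (map sign \<pi>s)"
      unfolding sg[OF T] using P by (auto simp: prod_list_map_eq_prod_nth seq_sgn_one_line intro!: prod.cong)
    \<comment> \<open>Column \<open>j\<close>, counted from 0, is the index of the factor
      \<open>i = Suc j\<close>.\<close>
    moreover have "vee (map (one_line k) \<pi>s) = (\<Prod>i\<in>{1..k}. evar (map (\<lambda>\<pi>. \<pi> i) \<pi>s))"
    proof -
      have "vee (map (one_line k) \<pi>s) = (\<Prod>j<k. evar (map (\<lambda>\<pi>. \<pi> (Suc j)) \<pi>s))"
        unfolding vee_def prod_list_map_eq_prod_nth
        by (auto simp: columns_all_tables[OF T d] nth_one_line o_def intro!: prod.cong arg_cong[of _ _ evar])
      also have "\<dots> = (\<Prod>i\<in>{1..k}. evar (map (\<lambda>\<pi>. \<pi> i) \<pi>s))"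
        by (rule prod.reindex_bij_witness[of _ "\<lambda>i. i - 1" Suc]) auto
      finally show ?thesis .
    qed
    ultimately show "?f (map (one_line k) \<pi>s) =
        of_int (prod_list (map sign \<pi>s)) * (\<Prod>i\<in>{1..k}. evar (map (\<lambda>\<pi>. \<pi> i) \<pi>s))" by simp
  qed
  also have "\<dots> = of_nat (fact k) * hyperdet d k"
  proof -
    have "of_nat (fact k) * Const (1 / fact k) = (Const (of_nat (fact k) * (1 / fact k)) :: tensor_poly)"
      by (simp add: Const_def mult_single flip: single_of_nat)
    also have "\<dots> = 1" by (simp add: Const_def)
    finally show ?thesis unfolding hyperdet_def mult.assoc[symmetric] by simp
  qed
  finally show ?thesis .
qed

section \<open>Words with equal letter counts\<close>

definition block_word :: "nat \<Rightarrow> nat \<Rightarrow> nat list" where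
  "block_word n k = concat (map (replicate k) [1..<Suc n])"

lemma block_word_Suc: "block_word (Suc n) k = block_word n k @ replicate k (Suc n)"
  by (simp add: block_word_def)

lemma set_block_word: "set (block_word n k) \<subseteq> {1..n}"
  by (induction n) (auto simp: block_word_Suc, simp add: block_word_def)

lemma block_word_in_words: "block_word n k \<in> words (replicate n k)"
proof -
  have "length (block_word n k) = n * k"
    by (induction n) (auto simp: block_word_Suc, simp add: block_word_def)
  moreover have "count_list (block_word n k) c = k" if "c \<in> {1..n}" for c
    using that
  proof (induction n)
    case (Suc n)
    have "count_list (block_word n k) (Suc n) = 0"
      using set_block_word[of n k] by (auto simp: count_list_0_iff)
    moreover have "count_list (replicate k a) c = (if a = c then k else 0)" for a c :: nat
      by (induction k) auto
    ultimately show ?case using Suc by (auto simp: block_word_Suc le_Suc_eq)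
  qed auto
  ultimately show ?thesis using set_block_word by (simp add: words_replicate_iff)
qed

text \<open>All these words are rearrangements of a single one, which makes \<open>word_sum\<close>
  constant on them and lets them be counted as permutations of a multiset.\<close>

lemma words_iff_mset_block_word: "w \<in> words (replicate n k) \<longleftrightarrow> mset w = mset (block_word n k)"
proof
  assume w: "w \<in> words (replicate n k)"
  show "mset w = mset (block_word n k)"
  proof (rule multiset_eqI)
    fix c
    have "count_list w c = count_list (block_word n k) c"
    proof (cases "c \<in> {1..n}")
      case True
      then show ?thesis using w block_word_in_words[of n k] by (simp add: words_replicate_iff)
    next
      case False
      then have "c \<notin> set w" "c \<notin> set (block_word n k)"
        using w set_block_word[of n k] by (auto simp: words_replicate_iff)
      then show ?thesis by (simp add: count_list_0_iff)
    qed
    then show "count (mset w) c = count (mset (block_word n k)) c" by (simp add: count_mset)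
  qed
next
  assume "mset w = mset (block_word n k)"
  then show "w \<in> words (replicate n k)" using words_cong_mset block_word_in_words by blast
qed

text \<open>The multinomial coefficient, stated without division.\<close>

lemma card_words:
  assumes "k \<ge> 1"
  shows "card (words (replicate n k)) * fact k ^ n = fact (n * k)"
proof -
  let ?A = "mset (block_word n k)"
  have cnt: "count ?A c = k" if "c \<in> {1..n}" for c
    using block_word_in_words[of n k] that by (auto simp: words_replicate_iff count_mset)
  have set: "set_mset ?A = {1..n}"
  proof
    show "{1..n} \<subseteq> set_mset ?A"
    proof
      fix c assume "c \<in> {1..n}"
      then have "count ?A c > 0" using cnt assms by simp
      then show "c \<in> set_mset ?A" by (simp only: count_greater_zero_iff)
    qed
  qed (use set_block_word[of n k] in simp)
  have "words (replicate n k) = permutations_of_multiset ?A"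
    by (auto simp: words_iff_mset_block_word permutations_of_multiset_def)
  moreover have "(\<Prod>c\<in>set_mset ?A. fact (count ?A c)) = (fact k ^ n :: nat)"
    unfolding set using cnt by simp
  moreover have "size ?A = n * k"
    using block_word_in_words[of n k] by (simp add: words_replicate_iff)
  ultimately show ?thesis using card_permutations_of_multiset_aux[of ?A] by simp
qed

text \<open>The blocks use different letters, so each of them contributes a factor
  \<open>fact k * hyperdet d k\<close>.\<close>

lemma word_sum_block_word:
  assumes d: "d \<ge> 1" and k: "k \<ge> 1"
  shows "word_sum d k (block_word n k) = of_nat (fact k) ^ n * hyperdet d k ^ n"
proof (induction n)
  case 0
  \<comment> \<open>For the empty word there is one table, with \<open>d\<close> empty rows, and its
    term is 1.\<close>
  have "all_tables d 0 k = {replicate d []}"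
    by (auto simp: all_tables_def intro: replicate_eqI) 
  then show ?case
    using d by (simp add: word_sum_def block_word_def sgn_table_def sgn_word_def vee_def columns_def)
next
  case (Suc n)
  have "set (block_word n k) \<inter> set (replicate k (Suc n)) = {}"
    using set_block_word[of n k] by auto
  then show ?case
    using Suc d k by (simp add: block_word_Suc word_sum_append word_sum_replicate mult_ac)
qed

text \<open>All words contribute the same, and their number times \<open>fact k ^ n\<close> is
  \<open>fact (n * k)\<close>.\<close>

lemma hyperdet_power_eq_sum_words:
  assumes d: "even d" "d \<ge> 1" and k: "k \<ge> 1"
  shows "of_nat (fact (n * k)) * hyperdet d k ^ n = (\<Sum>w\<in>words (replicate n k). word_sum d k w)"
proof -
  have "(\<Sum>w\<in>words (replicate n k). word_sum d k w)
      = (\<Sum>w\<in>words (replicate n k). of_nat (fact k) ^ n * hyperdet d k ^ n)"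
  proof (rule sum.cong[OF refl])
    fix w assume "w \<in> words (replicate n k)"
    then show "word_sum d k w = of_nat (fact k) ^ n * hyperdet d k ^ n"
      unfolding word_sum_block_word[OF d(2) k, symmetric]
      using d k block_word_in_words words_iff_mset_block_word by (intro word_sum_cong_mset) auto
  qed
  also have "\<dots> = of_nat (card (words (replicate n k)) * fact k ^ n) * hyperdet d k ^ n"
    by (simp add: mult.assoc del: of_nat_fact)
  finally show ?thesis unfolding card_words[OF k] by simp
qed

subsection \<open>Evaluation at the unit tensor\<close>

lemma Const_mult: "Const a * Const b = Const (a * b)"
  by (simp add: Const_def mult_single)

lemma of_nat_eq_Const: "of_nat a = Const (of_nat a)"
  by (simp add: Const_def)

lemma of_int_eq_Const: "of_int a = Const (of_int a)"
  by (simp add: Const_def)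

definition monomial_of :: "nat list list \<Rightarrow> nat list \<Rightarrow>\<^sub>0 nat" where
  "monomial_of C = sum_list (map (\<lambda>c. Poly_Mapping.single c 1) C)"

lemma vee_eq_single: "vee T = Poly_Mapping.single (monomial_of (columns T)) 1"
proof -
  have "prod_list (map evar C) = Poly_Mapping.single (monomial_of C) 1" for C
    by (induction C) (auto simp: monomial_of_def evar_def mult_single)
  then show ?thesis by (simp add: vee_def)
qed

lemma Const_mult_vee: "Const a * vee T = Poly_Mapping.single (monomial_of (columns T)) a"
  by (simp add: vee_eq_single Const_def mult_single)

definition monomial_value :: "(nat list \<Rightarrow> complex) \<Rightarrow> (nat list \<Rightarrow>\<^sub>0 nat) \<Rightarrow> complex" where
  "monomial_value f \<mu> = (\<Prod>c\<in>Poly_Mapping.keys \<mu>. f c ^ Poly_Mapping.lookup \<mu> c)"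

text \<open>Indices outside the keys only add factors \<open>f c ^ 0\<close>, so several monomials
  can be evaluated over a common index set.\<close>

lemma monomial_value_superset:
  assumes "finite A" "Poly_Mapping.keys \<mu> \<subseteq> A"
  shows "monomial_value f \<mu> = (\<Prod>c\<in>A. f c ^ Poly_Mapping.lookup \<mu> c)"
  unfolding monomial_value_def using assms
  by (intro prod.mono_neutral_left) (auto simp: in_keys_iff)

lemma monomial_value_add: "monomial_value f (\<mu> + \<nu>) = monomial_value f \<mu> * monomial_value f \<nu>"
proof -
  let ?A = "Poly_Mapping.keys \<mu> \<union> Poly_Mapping.keys \<nu>"
  have "monomial_value f (\<mu> + \<nu>) = (\<Prod>c\<in>?A. f c ^ Poly_Mapping.lookup (\<mu> + \<nu>) c)"
    by (rule monomial_value_superset) (auto dest: subsetD[OF Poly_Mapping.keys_add])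
  also have "\<dots> = (\<Prod>c\<in>?A. f c ^ Poly_Mapping.lookup \<mu> c) * (\<Prod>c\<in>?A. f c ^ Poly_Mapping.lookup \<nu> c)"
    by (simp add: lookup_add power_add prod.distrib)
  also have "\<dots> = monomial_value f \<mu> * monomial_value f \<nu>"
    by (simp add: monomial_value_superset[of ?A \<mu>] monomial_value_superset[of ?A \<nu>])
  finally show ?thesis .
qed

lemma monomial_value_monomial_of: "monomial_value f (monomial_of C) = prod_list (map f C)"
proof (induction C)
  case (Cons c C)
  have "monomial_value f (Poly_Mapping.single c 1) = f c" by (simp add: monomial_value_def)
  with Cons show ?case by (simp add: monomial_of_def monomial_value_add)
qed (simp add: monomial_of_def monomial_value_def)

lemma eval_poly_superset:
  assumes "finite A" "Poly_Mapping.keys p \<subseteq> A"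
  shows "eval_poly f p = (\<Sum>\<mu>\<in>A. Poly_Mapping.lookup p \<mu> * monomial_value f \<mu>)"
  unfolding eval_poly_def monomial_value_def[symmetric] using assms
  by (intro sum.mono_neutral_left) (auto simp: in_keys_iff)

lemma eval_poly_add: "eval_poly f (p + q) = eval_poly f p + eval_poly f q"
proof -
  let ?A = "Poly_Mapping.keys p \<union> Poly_Mapping.keys q"
  have "eval_poly f (p + q) = (\<Sum>\<mu>\<in>?A. Poly_Mapping.lookup (p + q) \<mu> * monomial_value f \<mu>)"
    by (rule eval_poly_superset) (auto dest: subsetD[OF Poly_Mapping.keys_add])
  also have "\<dots> = eval_poly f p + eval_poly f q"
    by (simp add: eval_poly_superset[of ?A p] eval_poly_superset[of ?A q] lookup_add distrib_right sum.distrib)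
  finally show ?thesis .
qed

lemma eval_poly_sum: "eval_poly f (\<Sum>x\<in>A. p x) = (\<Sum>x\<in>A. eval_poly f (p x))"
  by (induction A rule: infinite_finite_induct) (simp_all add: eval_poly_add, simp_all add: eval_poly_def)

lemma eval_poly_single: "eval_poly f (Poly_Mapping.single \<mu> a) = a * monomial_value f \<mu>"
  by (simp add: eval_poly_superset[of "{\<mu>}"])

lemma eval_poly_Const_mult_vee: "eval_poly f (Const a * vee T) = a * prod_list (map f (columns T))"
  by (simp add: Const_mult_vee eval_poly_single monomial_value_monomial_of)

text \<open>The product is nonzero only if every column is constant, which means that all rows are
  the same word.\<close>

lemma unit_tensor_columns:
  assumes X: "X \<in> all_tables d m n" and d: "d \<ge> 1"
  shows "prod_list (map (unit_tensor d n) (columns X)) =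
    (if X \<in> replicate d ` {x. set x \<subseteq> {1..n} \<and> length x = m} then 1 else 0)"
proof (cases "X \<in> replicate d ` {x. set x \<subseteq> {1..n} \<and> length x = m}")
  case True
  then obtain x where x: "X = replicate d x" "set x \<subseteq> {1..n}" "length x = m" by auto
  have "unit_tensor d n (map (\<lambda>t. t ! j) X) = 1" if "j < m" for j
  proof -
    have "x ! j \<in> {1..n}" using x that nth_mem[of j x] by blast
    then show ?thesis using x by (auto simp: unit_tensor_def map_replicate)
  qed
  then have "prod_list (map (unit_tensor d n) (columns X)) = 1"
    unfolding prod_list_map_eq_prod_nth by (intro prod.neutral) (auto simp: columns_all_tables[OF X d])
  then show ?thesis using True by simp
next
  case False
  have len: "length X = d" "\<And>t. t \<in> set X \<Longrightarrow> length t = m" "\<And>t. t \<in> set X \<Longrightarrow> set t \<subseteq> {1..n}"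
    using X by (auto simp: all_tables_def)
  have hd: "hd X \<in> set X" using len d by (intro hd_in_set) auto
  \<comment> \<open>Were all columns constant, every row would equal the first one.\<close>
  have "\<exists>j<m. \<forall>a. map (\<lambda>t. t ! j) X \<noteq> replicate d a"
  proof (rule ccontr)
    assume "\<not> ?thesis"
    then have "\<forall>j<m. \<exists>a. map (\<lambda>t. t ! j) X = replicate d a" by blast
    then have const: "t ! j = hd X ! j" if "j < m" "t \<in> set X" for t j
      using that hd by (metis (no_types, lifting) in_set_replicate image_eqI set_map)
    have "t = hd X" if t: "t \<in> set X" for t
    proof (rule nth_equalityI)
      show "length t = length (hd X)" using len(2)[OF t] len(2)[OF hd] by simp
      show "t ! j = hd X ! j" if "j < length t" for j
        using that len(2)[OF t] t by (intro const) simp_all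
    qed
    then have "X = replicate d (hd X)" using len(1) by (metis replicate_eqI)
    then show False using False hd len by blast
  qed
  then obtain j where j: "j < m" "\<And>a. map (\<lambda>t. t ! j) X \<noteq> replicate d a" by blast
  have "unit_tensor d n (map (\<lambda>t. t ! j) X) = 0" using j(2) by (simp add: unit_tensor_def)
  moreover have "map (\<lambda>t. t ! j) X \<in> set (columns X)" using j(1) by (auto simp: columns_all_tables[OF X d])
  ultimately have "0 \<in> set (map (unit_tensor d n) (columns X))" by (metis image_eqI set_map)
  then have "prod_list (map (unit_tensor d n) (columns X)) = 0" by (simp add: prod_list_zero_iff)
  then show ?thesis using False by simp
qed

text \<open>Only the tables \<open>replicate d x\<close> survive the evaluation, so the sum over
  tables becomes a sum over words.\<close>

lemma eval_Delta:
  assumes S: "length S = d" "length (hd S) = m" and d: "d \<ge> 1"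
  shows "eval_poly (unit_tensor d n) (Delta n S) = of_int (table_sign S) / of_nat (table_norm S) *
     of_int (\<Sum>x | set x \<subseteq> {1..n} \<and> length x = m. sgn_table S (replicate d x))"
proof -
  define a where "a = (of_int (table_sign S) / of_nat (table_norm S) :: complex)"
  let ?W = "{x. set x \<subseteq> {1..n} \<and> length x = m}"
  have "Delta n S = (\<Sum>X\<in>all_tables d m n. Const (a * of_int (sgn_table S X)) * vee X)"
    unfolding Delta_def S a_def[symmetric] sum_distrib_left
    by (simp only: of_int_eq_Const mult.assoc[symmetric] Const_mult)
  then have "eval_poly (unit_tensor d n) (Delta n S) = (\<Sum>X\<in>all_tables d m n.
      a * of_int (sgn_table S X) * prod_list (map (unit_tensor d n) (columns X)))"
    by (simp only: eval_poly_sum eval_poly_Const_mult_vee)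
  also have "\<dots> = (\<Sum>X\<in>replicate d ` ?W.
      a * of_int (sgn_table S X) * prod_list (map (unit_tensor d n) (columns X)))"
  proof (rule sum.mono_neutral_right[OF finite_all_tables])
    show "replicate d ` ?W \<subseteq> all_tables d m n" by (auto simp: all_tables_def)
    show "\<forall>X\<in>all_tables d m n - replicate d ` ?W.
        a * of_int (sgn_table S X) * prod_list (map (unit_tensor d n) (columns X)) = 0"
    proof
      fix X assume "X \<in> all_tables d m n - replicate d ` ?W"
      then have "prod_list (map (unit_tensor d n) (columns X)) = 0"
        using unit_tensor_columns[of X d m n] d by auto
      then show "a * of_int (sgn_table S X) * prod_list (map (unit_tensor d n) (columns X)) = 0" by simp
    qed
  qed
  also have "\<dots> = (\<Sum>X\<in>replicate d ` ?W. a * of_int (sgn_table S X))"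
  proof (rule sum.cong[OF refl])
    fix X assume "X \<in> replicate d ` ?W"
    moreover from this have "X \<in> all_tables d m n" by (auto simp: all_tables_def)
    ultimately show "a * of_int (sgn_table S X) * prod_list (map (unit_tensor d n) (columns X))
      = a * of_int (sgn_table S X)" using unit_tensor_columns[OF _ d] by simp
  qed
  \<comment> \<open>Different words give different tables because \<open>d \<ge> 1\<close>.\<close>
  also have "\<dots> = (\<Sum>x\<in>?W. a * of_int (sgn_table S (replicate d x)))"
    using d by (subst sum.reindex) (auto simp: inj_on_def)
  finally show ?thesis unfolding a_def of_int_sum sum_distrib_left .
qed

lemma tables_replicate_iff:
  "T \<in> tables (replicate d \<alpha>) \<longleftrightarrow> length T = d \<and> (\<forall>t\<in>set T. t \<in> words \<alpha>)"
  by (auto simp: tables_def list_all2_conv_all_nth all_set_conv_all_nth)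

lemma tables_subset_all_tables: "tables (replicate d (replicate k n)) \<subseteq> all_tables d (k * n) k"
proof
  fix T assume "T \<in> tables (replicate d (replicate k n))"
  then show "T \<in> all_tables d (k * n) k"
    unfolding tables_replicate_iff all_tables_def words_replicate_iff by blast
qed

text \<open>Words with wrong letter counts contribute 0; for the others
  \<open>sgn_table_transpose\<close> absorbs \<open>table_sign S\<close>.\<close>

lemma eval_Delta_words:
  assumes S: "S \<in> tables (replicate d (replicate k n))"
    and d: "even d" "d \<ge> 1" and kn: "k \<ge> 1" "n \<ge> 1"
  shows "eval_poly (unit_tensor d n) (Delta n S) =
    of_int (\<Sum>w\<in>words (replicate n k). sgn_table (replicate d w) S) / of_nat (table_norm S)"
proof -
  have len: "length S = d" and W: "\<And>s. s \<in> set S \<Longrightarrow> s \<in> words (replicate k n)"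
    using S by (auto simp: tables_replicate_iff)
  have hd: "length (hd S) = k * n"
    using all_tables_hd[OF subsetD[OF tables_subset_all_tables S] d(2)] .
  have "table_sign S * (\<Sum>x | set x \<subseteq> {1..n} \<and> length x = k * n. sgn_table S (replicate d x))
      = (\<Sum>x\<in>words (replicate n k). table_sign S * sgn_table S (replicate d x))"
    unfolding sum_distrib_left
  proof (rule sum.mono_neutral_right[OF finite_lists_length_eq], simp)
    show "words (replicate n k) \<subseteq> {x. set x \<subseteq> {1..n} \<and> length x = k * n}"
      by (auto simp: words_replicate_iff simp del: atLeastAtMost_iff)
    show "\<forall>x\<in>{x. set x \<subseteq> {1..n} \<and> length x = k * n} - words (replicate n k).
        table_sign S * sgn_table S (replicate d x) = 0"
      using sgn_table_nonzero_words[OF len W d(2) kn(2)] by auto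
  qed
  also have "\<dots> = (\<Sum>w\<in>words (replicate n k). sgn_table (replicate d w) S)"
    using sgn_table_transpose[OF len W d(1) _ kn] by (intro sum.cong refl) auto
  finally show ?thesis
    unfolding eval_Delta[OF len hd d(2)] times_divide_eq_left of_int_mult[symmetric] by simp
qed

subsection \<open>Collecting tables by their columns\<close>

text \<open>The inverse of \<open>columns\<close>. The number of rows is an argument because an
  empty list of columns does not determine it.\<close>

definition rows :: "nat \<Rightarrow> nat list list \<Rightarrow> nat list list" where
  "rows d C = map (\<lambda>l. map (\<lambda>c. c ! l) C) [0..<d]"

lemma rows_columns:
  assumes T: "T \<in> all_tables d m n" and d: "d \<ge> 1"
  shows "rows d (columns T) = T"
proof (rule nth_equalityI)
  have len: "length T = d" using T by (simp add: all_tables_def)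
  show "length (rows d (columns T)) = length T" by (simp add: rows_def len)
  fix l assume "l < length (rows d (columns T))"
  then have l: "l < d" by (simp add: rows_def)
  then have "length (T ! l) = m" using T len by (auto simp: all_tables_def)
  then show "rows d (columns T) ! l = T ! l"
    using l len map_nth[of "T ! l"] by (simp add: rows_def columns_all_tables[OF T d] o_def)
qed

lemma columns_rows:
  assumes C: "\<And>c. c \<in> set C \<Longrightarrow> length c = d" and d: "d \<ge> 1"
  shows "columns (rows d C) = C"
proof (rule nth_equalityI)
  have hd: "length (hd (rows d C)) = length C" using d by (simp add: rows_def hd_map)
  then show "length (columns (rows d C)) = length C" by (simp add: columns_def)
  fix j assume "j < length (columns (rows d C))"
  then have j: "j < length C" using hd by (simp add: columns_def)
  then have "length (C ! j) = d" using C by simp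
  then show "columns (rows d C) ! j = C ! j"
    using j hd map_nth[of "C ! j"] by (simp add: columns_def rows_def o_def)
qed

lemma length_columns_elem: "c \<in> set (columns T) \<Longrightarrow> length c = length T"
  by (auto simp: columns_def)

lemma sort_cong_mset: "mset xs = mset ys \<Longrightarrow> sort xs = sort ys"
  by (metis mset_sort properties_for_sort sorted_sort)

text \<open>Permuting the columns permutes the entries within each row and so keeps the letter
  counts.\<close>

lemma rows_in_tables_cong:
  assumes S: "S \<in> tables (replicate d (replicate k n))" and d: "d \<ge> 1"
    and C: "mset C = mset (columns S)"
  shows "rows d C \<in> tables (replicate d (replicate k n))"
proof -
  have Sr: "rows d (columns S) = S"
    using rows_columns[OF subsetD[OF tables_subset_all_tables S] d] .
  have "map (\<lambda>c. c ! l) C \<in> words (replicate k n)" if "l < d" for l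
  proof -
    have "mset (map (\<lambda>c. c ! l) C) = mset (map (\<lambda>c. c ! l) (columns S))" using C by simp
    moreover have "map (\<lambda>c. c ! l) (columns S) \<in> set (rows d (columns S))"
      using that by (auto simp: rows_def)
    then have "map (\<lambda>c. c ! l) (columns S) \<in> words (replicate k n)"
      unfolding Sr using S by (simp add: tables_replicate_iff)
    ultimately show ?thesis using words_cong_mset by blast
  qed
  then show ?thesis by (auto simp: tables_replicate_iff rows_def)
qed

text \<open>\<open>T\<close> arises from \<open>S\<close> by a permutation of the columns.
  Reindexing the sum over \<open>w\<close> by the same permutation makes
  \<open>sgn_table_permute\<close> applicable.\<close>

lemma sum_sgn_table_cong:
  assumes S: "S \<in> all_tables d (n * k) k" and T: "T \<in> all_tables d (n * k) k"
    and eq: "mset (columns T) = mset (columns S)"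
    and d: "even d" "d \<ge> 1" and k: "k \<ge> 1"
  shows "(\<Sum>w\<in>words (replicate n k). sgn_table (replicate d w) T)
       = (\<Sum>w\<in>words (replicate n k). sgn_table (replicate d w) S)"
proof -
  obtain \<sigma> where "\<sigma> permutes {..<length (columns S)}" "permute_list \<sigma> (columns S) = columns T"
    using mset_eq_permutation[OF eq] by auto
  then have \<sigma>: "\<sigma> permutes {..<n * k}" "permute_list \<sigma> (columns S) = columns T"
    by (auto simp: columns_all_tables[OF S d(2)])
  have "T = rows d (columns (map (permute_list \<sigma>) S))"
    unfolding columns_permute[OF \<sigma>(1) S d(2)] \<sigma>(2) using rows_columns[OF T d(2)] by simp
  then have T_eq: "T = map (permute_list \<sigma>) S"
    using rows_columns[OF map_permute_list_in_all_tables[OF \<sigma>(1) S] d(2)] by simp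
  have len: "length w = n * k" if "w \<in> words (replicate n k)" for w
    using that by (simp add: words_replicate_iff)
  have perm: "permute_list \<tau> w \<in> words (replicate n k)"
    if "\<tau> permutes {..<n * k}" "w \<in> words (replicate n k)" for \<tau> w
    using that len[OF that(2)] by (subst words_cong_mset[of _ w]) auto
  have bij: "bij_betw (permute_list \<sigma>) (words (replicate n k)) (words (replicate n k))"
  proof (rule bij_betw_byWitness[of _ "permute_list (inv \<sigma>)"])
    show "\<forall>w\<in>words (replicate n k). permute_list (inv \<sigma>) (permute_list \<sigma> w) = w"
      using \<sigma>(1) len by (auto intro: permute_list_inverse)
    show "\<forall>w\<in>words (replicate n k). permute_list \<sigma> (permute_list (inv \<sigma>) w) = w"
      using permute_list_inverse[of "inv \<sigma>"] permutes_inv[OF \<sigma>(1)] permutes_inv_inv[OF \<sigma>(1)] len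
      by metis
  qed (use perm \<sigma>(1) permutes_inv[OF \<sigma>(1)] in auto)
  have "(\<Sum>w\<in>words (replicate n k). sgn_table (replicate d w) T)
      = (\<Sum>w\<in>words (replicate n k). sgn_table (replicate d (permute_list \<sigma> w)) T)"
    by (rule sum.reindex_bij_betw[OF bij, symmetric])
  also have "\<dots> = (\<Sum>w\<in>words (replicate n k). sgn_table (replicate d w) S)"
    unfolding T_eq using S
    by (intro sum.cong refl sgn_table_permute[OF \<sigma>(1) _ _ _ d(1) k]) (auto simp: all_tables_def)
  finally show ?thesis .
qed

text \<open>\<open>rows d (sort (columns T))\<close> is the sorted representative of
  \<open>T\<close>. The tables represented by \<open>S\<close> are the arrangements of the columns
  of \<open>S\<close>, and these are counted by a multinomial coefficient with denominator
  \<open>table_norm S\<close>.\<close>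

lemma card_same_columns:
  assumes S: "S \<in> lex_tables (replicate d (replicate k n))" and d: "d \<ge> 1"
  shows "card {T \<in> tables (replicate d (replicate k n)). rows d (sort (columns T)) = S} * table_norm S
    = fact (k * n)"
proof -
  let ?A = "tables (replicate d (replicate k n))" and ?M = "mset (columns S)"
  have SA: "S \<in> ?A" and sorted: "sorted (columns S)" using S by (auto simp: lex_tables_def)
  have all: "T \<in> all_tables d (k * n) k" if "T \<in> ?A" for T
    using that tables_subset_all_tables by blast
  have lenA: "length T = d" if "T \<in> ?A" for T using that by (simp add: tables_replicate_iff)
  have "bij_betw columns {T \<in> ?A. rows d (sort (columns T)) = S} (permutations_of_multiset ?M)"
  proof (rule bij_betw_byWitness[of _ "rows d"])
    show "\<forall>T\<in>{T \<in> ?A. rows d (sort (columns T)) = S}. rows d (columns T) = T"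
      using rows_columns[OF all d] by auto
    have len: "length c = d" if "mset C = ?M" "c \<in> set C" for C c
      using that mset_eq_setD[OF that(1)] length_columns_elem[of c S] lenA[OF SA] by auto
    show "\<forall>C\<in>permutations_of_multiset ?M. columns (rows d C) = C"
      using columns_rows[OF len d] by (auto simp: permutations_of_multiset_def)
    show "columns ` {T \<in> ?A. rows d (sort (columns T)) = S} \<subseteq> permutations_of_multiset ?M"
    proof clarify
      fix T assume T: "T \<in> ?A" "S = rows d (sort (columns T))"
      then have "columns S = sort (columns T)"
        using columns_rows[of "sort (columns T)" d] length_columns_elem[of _ T] lenA[OF T(1)] d by auto
      then show "columns T \<in> permutations_of_multiset (mset (columns (rows d (sort (columns T)))))"
        using T(2) by (simp add: permutations_of_multiset_def)
    qed
    show "rows d ` permutations_of_multiset ?M \<subseteq> {T \<in> ?A. rows d (sort (columns T)) = S}"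
    proof clarify
      fix C assume "C \<in> permutations_of_multiset ?M"
      then have C: "mset C = ?M" by (simp add: permutations_of_multiset_def)
      have "sort C = columns S" using sort_cong_mset[OF C] sorted by (simp add: sorted_sort_id)
      then show "rows d C \<in> ?A \<and> rows d (sort (columns (rows d C))) = S"
        using rows_in_tables_cong[OF SA d C] columns_rows[OF len[OF C] d] rows_columns[OF all[OF SA] d]
        by simp
    qed
  qed
  then have "card {T \<in> ?A. rows d (sort (columns T)) = S} = card (permutations_of_multiset ?M)"
    by (rule bij_betw_same_card)
  moreover have "table_norm S = (\<Prod>c\<in>set_mset ?M. fact (count ?M c))"
    by (simp add: table_norm_def count_mset)
  moreover have "size ?M = k * n" by (simp add: columns_all_tables[OF all[OF SA] d])
  ultimately show ?thesis using card_permutations_of_multiset_aux[of ?M] by simp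
qed

text \<open>Both sides are compared after multiplication by \<open>fact (n * k)\<close>.\<close>

theorem hyperdet_power:
  assumes d: "even d" "d \<ge> 1" and kn: "k \<ge> 1" "n \<ge> 1"
  shows "hyperdet d k ^ n = (\<Sum>S\<in>lex_tables (replicate d (replicate k n)).
     Const (eval_poly (unit_tensor d n) (Delta n S)) * vee S)"
proof -
  let ?m = "n * k" and ?W = "words (replicate n k)"
  let ?A = "tables (replicate d (replicate k n))" and ?L = "lex_tables (replicate d (replicate k n))"
  \<comment> \<open>\<open>F T\<close> is the total sign with which the table \<open>T\<close>
    occurs in the sum over all words.\<close>
  define F where "F = (\<lambda>T. \<Sum>w\<in>?W. sgn_table (replicate d w) T)"
  have sub: "?A \<subseteq> all_tables d ?m k" using tables_subset_all_tables by (simp add: mult.commute)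
  then have fin: "finite ?A" using finite_all_tables finite_subset by blast
  have LA: "?L \<subseteq> ?A" by (auto simp: lex_tables_def)
  have finL: "finite ?L" using fin LA finite_subset by blast
  have "of_nat (fact ?m) * hyperdet d k ^ n
      = (\<Sum>w\<in>?W. \<Sum>T\<in>all_tables d ?m k. of_int (sgn_table (replicate d w) T) * vee T)"
    unfolding hyperdet_power_eq_sum_words[OF d kn(1)]
    by (rule sum.cong) (auto simp: word_sum_def words_replicate_iff)
  also have "\<dots> = (\<Sum>T\<in>all_tables d ?m k. of_int (F T) * vee T)"
    unfolding F_def of_int_sum sum_distrib_right by (rule sum.swap)
  also have "\<dots> = (\<Sum>T\<in>?A. of_int (F T) * vee T)"
  proof (rule sum.mono_neutral_right[OF finite_all_tables sub], rule ballI)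
    fix T assume T: "T \<in> all_tables d ?m k - ?A"
    have "sgn_table (replicate d w) T = 0" if "w \<in> ?W" for w
    proof (rule ccontr)
      assume "sgn_table (replicate d w) T \<noteq> 0"
      then have "T \<in> ?A"
        using T sgn_table_replicate_nonzero_words[OF _ _ kn(1) that]
        by (auto simp: tables_replicate_iff all_tables_def)
      then show False using T by blast
    qed
    then show "of_int (F T) * vee T = 0" by (simp add: F_def)
  qed
  \<comment> \<open>Tables are grouped by their sorted representative. Within a group both
    \<open>F T\<close> and \<open>vee T\<close> are constant.\<close>
  also have "\<dots> = (\<Sum>S\<in>?L. \<Sum>T\<in>{T \<in> ?A. rows d (sort (columns T)) = S}. of_int (F T) * vee T)"
  proof (rule sum.group[symmetric, OF fin finL], clarify)
    fix T assume T: "T \<in> ?A"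
    then have "length T = d" by (simp add: tables_replicate_iff)
    then have "columns (rows d (sort (columns T))) = sort (columns T)"
      using length_columns_elem[of _ T] d by (intro columns_rows) auto
    then show "rows d (sort (columns T)) \<in> ?L"
      using rows_in_tables_cong[OF T d(2), of "sort (columns T)"] by (simp add: lex_tables_def)
  qed
  also have "\<dots> = (\<Sum>S\<in>?L. of_nat (fact ?m) * (Const (eval_poly (unit_tensor d n) (Delta n S)) * vee S))"
  proof (rule sum.cong[OF refl])
    fix S assume S: "S \<in> ?L"
    then have SA: "S \<in> ?A" using LA by blast
    let ?G = "{T \<in> ?A. rows d (sort (columns T)) = S}"
    have "(\<Sum>T\<in>?G. of_int (F T) * vee T) = (\<Sum>T\<in>?G. of_int (F S) * vee S)"
    proof (rule sum.cong[OF refl])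
      fix T assume T: "T \<in> ?G"
      then have "length T = d" by (simp add: tables_replicate_iff)
      then have "columns (rows d (sort (columns T))) = sort (columns T)"
        using length_columns_elem[of _ T] d by (intro columns_rows) auto
      then have eq: "mset (columns T) = mset (columns S)" using T by auto
      have "T \<in> all_tables d ?m k" "S \<in> all_tables d ?m k" using T SA sub by auto
      then have "F T = F S" unfolding F_def using sum_sgn_table_cong[OF _ _ eq d kn(1)] by blast
      then show "of_int (F T) * vee T = of_int (F S) * vee S" using vee_cong_mset[OF eq] by simp
    qed
    also have "\<dots> = Const (of_nat (card ?G) * of_int (F S)) * vee S"
      by (simp add: of_nat_eq_Const of_int_eq_Const Const_mult mult.assoc[symmetric])
    also have "of_nat (card ?G) * of_int (F S) = (of_nat (fact ?m) * (of_int (F S) / of_nat (table_norm S)) :: complex)"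
    proof -
      have "table_norm S \<noteq> 0" by (simp add: table_norm_def)
      moreover have "(of_nat (fact ?m) :: complex) = of_nat (card ?G) * of_nat (table_norm S)"
        using card_same_columns[OF S d(2)] by (simp add: mult.commute[of n k] flip: of_nat_mult)
      ultimately show ?thesis by (simp del: of_nat_fact)
    qed
    also have "of_int (F S) / of_nat (table_norm S) = eval_poly (unit_tensor d n) (Delta n S)"
      unfolding F_def using eval_Delta_words[OF SA d kn] by simp
    finally show "(\<Sum>T\<in>?G. of_int (F T) * vee T)
        = of_nat (fact ?m) * (Const (eval_poly (unit_tensor d n) (Delta n S)) * vee S)"
      by (simp add: of_nat_eq_Const Const_mult mult.assoc[symmetric] del: of_nat_fact)
  qed
  finally have eq: "of_nat (fact ?m) * hyperdet d k ^ n = of_nat (fact ?m) *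
      (\<Sum>S\<in>?L. Const (eval_poly (unit_tensor d n) (Delta n S)) * vee S)"
    by (simp add: sum_distrib_left)
  \<comment> \<open>The factorial is cancelled by multiplying with the constant polynomial of its
    reciprocal.\<close>
  have inv: "Const (1 / of_nat (fact ?m)) * (of_nat (fact ?m) * p) = p" for p :: tensor_poly
    by (simp add: of_nat_eq_Const Const_mult mult.assoc[symmetric] del: of_nat_fact)
      (simp add: Const_def)
  show ?thesis using arg_cong[OF eq, of "\<lambda>p. Const (1 / of_nat (fact ?m)) * p"] unfolding inv .
qed

subsection \<open>Latin hypercubes\<close>

lemma finite_cells: "finite (cells d k)"
  using finite_lists_length_eq[of "{1..k}" d] by (simp add: cells_def conj_commute)

lemma card_cells: "card (cells d k) = k ^ d"
  using card_lists_length_eq[of "{1..k}" d] by (simp add: cells_def conj_commute)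

text \<open>Deleting the coordinate \<open>l\<close>, which is fixed on the slice, leaves an
  arbitrary cell of dimension \<open>d - 1\<close>.\<close>

lemma card_slice:
  assumes "l < d" "j \<in> {1..k}"
  shows "card (slice d k l j) = k ^ (d - 1)"
proof -
  have "bij_betw (\<lambda>c. take l c @ drop (Suc l) c) (slice d k l j) (cells (d - 1) k)"
  proof (rule bij_betw_byWitness[of _ "\<lambda>c. take l c @ j # drop l c"])
    show "\<forall>c\<in>slice d k l j. take l (take l c @ drop (Suc l) c) @ j # drop l (take l c @ drop (Suc l) c) = c"
      using assms by (auto simp: slice_def cells_def min_def id_take_nth_drop[symmetric])
    show "\<forall>c\<in>cells (d - 1) k. take l (take l c @ j # drop l c) @ drop (Suc l) (take l c @ j # drop l c) = c"
      using assms by (auto simp: cells_def min_def)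
    show "(\<lambda>c. take l c @ drop (Suc l) c) ` slice d k l j \<subseteq> cells (d - 1) k"
      using assms set_take_subset set_drop_subset by (fastforce simp: slice_def cells_def)
    show "(\<lambda>c. take l c @ j # drop l c) ` cells (d - 1) k \<subseteq> slice d k l j"
    proof
      fix c' assume "c' \<in> (\<lambda>c. take l c @ j # drop l c) ` cells (d - 1) k"
      then obtain c where c: "c' = take l c @ j # drop l c" "length c = d - 1" "set c \<subseteq> {1..k}"
        by (auto simp: cells_def)
      have "set c' \<subseteq> {1..k}"
        using c set_take_subset[of l c] set_drop_subset[of l c] assms(2) by auto
      then show "c' \<in> slice d k l j" using c assms(1) by (simp add: slice_def cells_def nth_append)
    qed
  qed
  then show ?thesis using bij_betw_same_card card_cells by metis
qed

lemma filter_sorted_list_of_set: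
  fixes A :: "'a::linorder set"
  assumes "finite A"
  shows "filter P (sorted_list_of_set A) = sorted_list_of_set {a \<in> A. P a}"
  using assms by (intro sorted_distinct_set_unique) (auto simp: sorted_wrt_filter)

lemma map_nth_filter_nth:
  "map (\<lambda>b. f (xs ! b)) (filter (\<lambda>b. P (xs ! b)) [0..<length xs]) = map f (filter P xs)"
proof -
  have "map f (filter P xs) = map f (filter P (map ((!) xs) [0..<length xs]))" by (simp add: map_nth)
  then show ?thesis by (simp add: filter_map o_def)
qed

section \<open>The monomial of all cells and its table\<close>

lemma lookup_monomial_of: "Poly_Mapping.lookup (monomial_of C) c = count_list C c"
  by (induction C) (auto simp: monomial_of_def lookup_add lookup_single when_def)

text \<open>The exponent vector and the multiset both record how often each index occurs.\<close>

lemma monomial_of_eq_iff: "monomial_of C = monomial_of C' \<longleftrightarrow> mset C = mset C'"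
proof
  assume "monomial_of C = monomial_of C'"
  then show "mset C = mset C'" by (intro multiset_eqI) (metis count_mset lookup_monomial_of)
next
  assume "mset C = mset C'"
  then show "monomial_of C = monomial_of C'"
    unfolding monomial_of_def by (metis mset_map sum_mset_sum_list)
qed

lemma monomial_of_cells: "monomial_of (sorted_list_of_set (cells d k)) = full_monomial d k"
  unfolding monomial_of_def full_monomial_def
  using finite_cells by (simp add: sum_list_distinct_conv_sum_set)

text \<open>The sorted table that belongs to \<open>full_monomial d k\<close>.\<close>

definition cell_table :: "nat \<Rightarrow> nat \<Rightarrow> nat list list" where
  "cell_table d k = rows d (sorted_list_of_set (cells d k))"

lemma columns_cell_table:
  assumes "d \<ge> 1"
  shows "columns (cell_table d k) = sorted_list_of_set (cells d k)"
  unfolding cell_table_def using assms finite_cells by (intro columns_rows) (auto simp: cells_def)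

lemma nth_cell_table: "l < d \<Longrightarrow> cell_table d k ! l = map (\<lambda>c. c ! l) (sorted_list_of_set (cells d k))"
  by (simp add: cell_table_def rows_def)

text \<open>The letter \<open>j\<close> occurs in row \<open>l\<close> once for each cell of the
  slice \<open>slice d k l j\<close>.\<close>

lemma cell_table_row_in_words:
  assumes "l < d"
  shows "cell_table d k ! l \<in> words (replicate k (k ^ (d - 1)))"
  unfolding words_replicate_iff nth_cell_table[OF assms]
proof (intro conjI ballI)
  show "length (map (\<lambda>c. c ! l) (sorted_list_of_set (cells d k))) = k * k ^ (d - 1)"
    using assms by (simp add: card_cells flip: power_Suc)
  show "set (map (\<lambda>c. c ! l) (sorted_list_of_set (cells d k))) \<subseteq> {1..k}"
    using assms finite_cells nth_mem by (fastforce simp: cells_def)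
  fix j assume j: "j \<in> {1..k}"
  have "count_list (map (\<lambda>c. c ! l) (sorted_list_of_set (cells d k))) j
      = length (filter (\<lambda>c. c ! l = j) (sorted_list_of_set (cells d k)))"
    by (simp add: count_list_eq_length_filter filter_map o_def eq_commute[of j])
  also have "\<dots> = card (slice d k l j)"
    by (simp add: filter_sorted_list_of_set finite_cells slice_def)
  finally show "count_list (map (\<lambda>c. c ! l) (sorted_list_of_set (cells d k))) j = k ^ (d - 1)"
    using card_slice[OF assms j] by simp
qed

lemma cell_table_in_lex_tables:
  assumes "d \<ge> 1"
  shows "cell_table d k \<in> lex_tables (replicate d (replicate k (k ^ (d - 1))))"
proof -
  have len: "length (cell_table d k) = d" by (simp add: cell_table_def rows_def)
  then have "cell_table d k \<in> tables (replicate d (replicate k (k ^ (d - 1))))"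
    using cell_table_row_in_words by (auto simp: tables_replicate_iff in_set_conv_nth)
  then show ?thesis by (simp add: lex_tables_def columns_cell_table[OF assms])
qed

text \<open>Positions of the table are the cells in lexicographic order. Those with letter
  \<open>j\<close> in row \<open>l\<close> form a slice, and the corresponding factor is the sign of
  \<open>L\<close> read along it.\<close>

lemma sgn_table_cell_table:
  assumes "k \<ge> 1"
  shows "sgn_table (cell_table d k) (replicate d (map L (sorted_list_of_set (cells d k)))) = latin_sign d k L"
proof -
  let ?C = "sorted_list_of_set (cells d k)"
  have "sgn_word (cell_table d k ! l) (map L ?C)
      = (\<Prod>j\<in>{1..k}. seq_sgn (map L (sorted_list_of_set (slice d k l j))))" if l: "l < d" for l
  proof -
    have "map (\<lambda>b. map L ?C ! b) (filter (\<lambda>b. cell_table d k ! l ! b = j) [0..<length (cell_table d k ! l)])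
        = map L (sorted_list_of_set (slice d k l j))" for j
    proof -
      have "map (\<lambda>b. map L ?C ! b) (filter (\<lambda>b. cell_table d k ! l ! b = j) [0..<length (cell_table d k ! l)])
          = map (\<lambda>b. L (?C ! b)) (filter (\<lambda>b. ?C ! b ! l = j) [0..<length ?C])"
        unfolding nth_cell_table[OF l] by (auto intro!: map_cong filter_cong)
      also have "\<dots> = map L (filter (\<lambda>c. c ! l = j) ?C)" by (rule map_nth_filter_nth)
      finally show ?thesis by (simp add: filter_sorted_list_of_set finite_cells slice_def)
    qed
    moreover have "set (cell_table d k ! l) = {1..k}"
      using set_words[OF cell_table_row_in_words[OF l]] assms by simp
    ultimately show ?thesis unfolding sgn_word_def by simp
  qed
  then show ?thesis
    unfolding sgn_table_def latin_sign_def
    by (auto simp: cell_table_def rows_def intro!: prod.cong)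
qed

text \<open>Identifies words with labellings of the cells; extensionality fixes a labelling outside
  \<open>A\<close>.\<close>

lemma bij_betw_map_sorted_list_of_set:
  fixes A :: "'a::linorder set" and B :: "'b set"
  assumes A: "finite A"
  shows "bij_betw (\<lambda>L. map L (sorted_list_of_set A)) (A \<rightarrow>\<^sub>E B) {x. set x \<subseteq> B \<and> length x = card A}"
  unfolding bij_betw_def
proof
  let ?C = "sorted_list_of_set A"
  show "inj_on (\<lambda>L. map L ?C) (A \<rightarrow>\<^sub>E B)"
    using A by (auto simp: inj_on_def intro: PiE_ext)
  show "(\<lambda>L. map L ?C) ` (A \<rightarrow>\<^sub>E B) = {x. set x \<subseteq> B \<and> length x = card A}"
  proof (intro equalityI subsetI)
    fix x assume "x \<in> {x. set x \<subseteq> B \<and> length x = card A}"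
    then have x: "set x \<subseteq> B" "length x = length ?C" by auto
    define L where "L = restrict (\<lambda>a. the (map_of (zip ?C x) a)) A"
    have nth: "L (?C ! i) = x ! i" if "i < length ?C" for i
    proof -
      have "?C ! i \<in> A" using nth_mem[OF that] A by simp
      then show ?thesis using that x by (simp add: L_def map_of_zip_nth)
    qed
    have eq: "map L ?C = x" using x nth by (intro nth_equalityI) auto
    have "L ` A \<subseteq> B" using eq x(1) A by (metis set_map set_sorted_list_of_set)
    then have "L \<in> A \<rightarrow>\<^sub>E B" by (auto simp: L_def)
    then show "x \<in> (\<lambda>L. map L ?C) ` (A \<rightarrow>\<^sub>E B)" using eq by blast
  qed (use A in auto)
qed

text \<open>A labelling that is not a Latin hypercube fails to be a bijection on some slice, and
  there its sign is 0.\<close>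

lemma AT_eq_sum_functions: "AT d k = (\<Sum>L\<in>cells d k \<rightarrow>\<^sub>E {1..k ^ (d - 1)}. latin_sign d k L)"
  unfolding AT_def
proof (rule sum.mono_neutral_left)
  show "finite (cells d k \<rightarrow>\<^sub>E {1..k ^ (d - 1)})" by (intro finite_PiE finite_cells) simp
  show "latin_hypercubes d k \<subseteq> cells d k \<rightarrow>\<^sub>E {1..k ^ (d - 1)}" by (auto simp: latin_hypercubes_def)
  show "\<forall>L\<in>(cells d k \<rightarrow>\<^sub>E {1..k ^ (d - 1)}) - latin_hypercubes d k. latin_sign d k L = 0"
  proof
    fix L assume "L \<in> (cells d k \<rightarrow>\<^sub>E {1..k ^ (d - 1)}) - latin_hypercubes d k"
    then obtain l j where lj: "l < d" "j \<in> {1..k}" "\<not> bij_betw L (slice d k l j) {1..k ^ (d - 1)}"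
      unfolding latin_hypercubes_def by blast
    have fin: "finite (slice d k l j)" using finite_cells by (simp add: slice_def)
    have "seq_sgn (map L (sorted_list_of_set (slice d k l j))) = 0"
      \<comment> \<open>The slice has \<open>k ^ (d - 1)\<close> cells, so a nonzero
        \<open>seq_sgn\<close> would make \<open>L\<close> a bijection onto
        \<open>{1..k ^ (d - 1)}\<close>.\<close>
      using lj(3) card_slice[OF lj(1,2)] fin by (auto simp: seq_sgn_def bij_betw_def distinct_map)
    then have "(\<Prod>j\<in>{1..k}. seq_sgn (map L (sorted_list_of_set (slice d k l j)))) = 0"
      using lj(2) by (intro prod_zero) auto
    then show "latin_sign d k L = 0"
      unfolding latin_sign_def using lj(1) by (intro prod_zero) auto
  qed
qed

text \<open>The columns are distinct, so \<open>table_norm\<close> is 1, and the sum over words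
  becomes a sum over labellings of the cells.\<close>

lemma eval_Delta_cell_table:
  assumes d: "d \<ge> 1" and k: "k \<ge> 1"
  shows "eval_poly (unit_tensor d (k ^ (d - 1))) (Delta (k ^ (d - 1)) (cell_table d k))
    = of_int (table_sign (cell_table d k) * AT d k)"
proof -
  let ?C = "sorted_list_of_set (cells d k)" and ?n = "k ^ (d - 1)"
  have len: "length (cell_table d k) = d" by (simp add: cell_table_def rows_def)
  have hd: "length (hd (cell_table d k)) = card (cells d k)"
    using d by (simp add: cell_table_def rows_def hd_map)
  have "count_list ?C c = 1" if "c \<in> cells d k" for c
    using that finite_cells distinct_count_atmost_1[of ?C] by (simp flip: count_mset)
  then have norm: "table_norm (cell_table d k) = 1"
    unfolding table_norm_def columns_cell_table[OF d] using finite_cells by simp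
  have "(\<Sum>x | set x \<subseteq> {1..?n} \<and> length x = card (cells d k). sgn_table (cell_table d k) (replicate d x))
      = (\<Sum>L\<in>cells d k \<rightarrow>\<^sub>E {1..?n}. sgn_table (cell_table d k) (replicate d (map L ?C)))"
    by (rule sum.reindex_bij_betw[OF bij_betw_map_sorted_list_of_set[OF finite_cells], symmetric])
  also have "\<dots> = AT d k" by (simp only: sgn_table_cell_table[OF k] AT_eq_sum_functions)
  finally show ?thesis unfolding eval_Delta[OF len hd d] norm by simp
qed

lemma table_sign_cases: "table_sign T = 1 \<or> table_sign T = - 1"
  unfolding table_sign_def by (induction T) (auto simp: word_sign_def uminus_power_if)

text \<open>A sorted table is determined by its monomial, so a single summand of
  \<open>hyperdet_power\<close> contributes to this coefficient.\<close>

lemma lookup_hyperdet_power: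
  assumes d: "even d" "d \<ge> 1" and k: "k \<ge> 1"
  shows "Poly_Mapping.lookup (hyperdet d k ^ (k ^ (d - 1))) (full_monomial d k)
    = of_int (table_sign (cell_table d k) * AT d k)"
proof -
  let ?n = "k ^ (d - 1)"
  let ?L = "lex_tables (replicate d (replicate k ?n))"
  let ?a = "\<lambda>S. eval_poly (unit_tensor d ?n) (Delta ?n S)"
  have n: "?n \<ge> 1" using k by simp
  have iff: "monomial_of (columns S) = full_monomial d k \<longleftrightarrow> S = cell_table d k" if S: "S \<in> ?L" for S
  proof
    assume "monomial_of (columns S) = full_monomial d k"
    then have "mset (columns S) = mset (sorted_list_of_set (cells d k))"
      by (simp only: monomial_of_cells[symmetric] monomial_of_eq_iff)
    moreover have "sorted (columns S)" using S by (simp add: lex_tables_def)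
    ultimately have "columns S = sorted_list_of_set (cells d k)"
      by (metis properties_for_sort sorted_sort_id sorted_list_of_set.sorted_sorted_key_list_of_set)
    moreover have "S \<in> all_tables d (k * ?n) k"
      using S tables_subset_all_tables by (auto simp: lex_tables_def)
    ultimately show "S = cell_table d k" using rows_columns d(2) unfolding cell_table_def by metis
  qed (simp add: columns_cell_table[OF d(2)] monomial_of_cells)
  have "finite ?L"
    by (rule finite_subset[OF _ finite_all_tables[of d "k * ?n" k]])
      (use tables_subset_all_tables in \<open>auto simp: lex_tables_def\<close>)
  have "Poly_Mapping.lookup (hyperdet d k ^ ?n) (full_monomial d k)
      = (\<Sum>S\<in>?L. if S = cell_table d k then ?a S else 0)"
    unfolding hyperdet_power[OF d k n] lookup_sum Const_mult_vee
    using iff by (intro sum.cong refl) (auto simp: lookup_single when_def)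
  also have "\<dots> = ?a (cell_table d k)"
    using \<open>finite ?L\<close> cell_table_in_lex_tables[OF d(2)] by simp
  also have "\<dots> = of_int (table_sign (cell_table d k) * AT d k)" by (rule eval_Delta_cell_table[OF d(2) k])
  finally show ?thesis .
qed

theorem mainTheorem14:
  fixes d k :: nat
  assumes "d \<ge> 2" and "even d" and "k \<ge> 1"
  shows "(\<forall>n\<ge>1. hyperdet d k ^ n =
            (\<Sum>S\<in>lex_tables (replicate d (replicate k n)).
               Const (eval_poly (unit_tensor d n) (Delta n S)) * vee S)) \<and>
         (Poly_Mapping.lookup (hyperdet d k ^ (k ^ (d - 1))) (full_monomial d k) = of_int (AT d k) \<or>
          Poly_Mapping.lookup (hyperdet d k ^ (k ^ (d - 1))) (full_monomial d k) = - of_int (AT d k))"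
proof -
  have d: "d \<ge> 1" using assms(1) by simp
  \<comment> \<open>The undetermined sign is \<open>table_sign (cell_table d k)\<close>.\<close>
  show ?thesis
    using hyperdet_power[OF assms(2) d assms(3)] lookup_hyperdet_power[OF assms(2) d assms(3)]
      table_sign_cases[of "cell_table d k"] by auto
qed

end
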